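(* For every integer $r\ge3$ there exists $\delta=\delta(r)>0$ such that whp $S(G_{n/2}^{\mathcal D_r})=\omega(1)$ and $L_1(G_{n/2+\delta n}^{\mathcal D_r})=o(n)$; that is, $S(G_{n/2}^{\mathcal D_r})\overset{\mathrm p}{\to}\infty$ and $L_1(G_{n/2+\delta n}^{\mathcal D_r})/n\overset{\mathrm p}{\to}0$ as $n\to\infty$.
   Context: For each $n$, the rule $\mathcal D_r$ defines a random sequence $(G_i^{\mathcal D_r})_{i\ge0}$ of graphs on $[n]$ as follows. $G_0^{\mathcal D_r}$ is the empty graph (no edges). In step $i+1$, $2r$ vertices $v_1,\ldots,v_{2r}$ are chosen from $[n]$ independently and uniformly at random (independently of previous steps); let $c_j$ be the size (number of vertices) of the component of $G_i^{\mathcal D_r}$ containing $v_j$. During the first $n/2$ steps the pair $v_1v_2$ is added. In all later steps the $r$-sum rule $\mathcal S_r$ is used: the pair $v_{2j-1}v_{2j}$ is added, where $j\in\{1,\ldots,r\}$ is the (smallest, if there are ties) index minimizing $c_{2j-1}+c_{2j}$. (A pair with $v_a=v_b$ or an already present edge does not affect the component structure.) $L_1(G)$ is the number of vertices in a largest component of $G$; for an $n$-vertex graph $G$, $S(G)=\sum_{k}kN_k(G)/n$, where $N_k(G)$ is the number of vertices in components of size $k$. $\overset{\mathrm p}{\to}$ denotes convergence in probability; $X_n\overset{\mathrm p}{\to}\infty$ means $\Pr(X_n\le C)\to0$ for every $C>0$. "Whp" means with probability tending to $1$ as $n\to\infty$. Rounding to integers is ignored. *)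

theory Defs
  imports "HOL-Probability.Probability"
begin

text \<open>
  A graph on the vertex set \<open>{1..n}\<close> is given by its set of edges, an edge joining \<open>x\<close> and \<open>y\<close>
  being the set \<open>{x, y}\<close>.  Singletons (loops) may occur; they do not affect the components.
\<close>

type_synonym edges = "nat set set"

definition component :: "edges \<Rightarrow> nat \<Rightarrow> nat set" where
  "component E v = {w. (v, w) \<in> {(x, y). {x, y} \<in> E}\<^sup>*}"

definition components :: "nat \<Rightarrow> edges \<Rightarrow> nat set set" where
  "components n E = component E ` {1..n}"

definition L1 :: "nat \<Rightarrow> edges \<Rightarrow> nat" where
  "L1 n E = Max (card ` components n E)"

definition vertices_in_size :: "nat \<Rightarrow> edges \<Rightarrow> nat \<Rightarrow> nat" where
  "vertices_in_size n E k = card {v \<in> {1..n}. card (component E v) = k}"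

definition susceptibility :: "nat \<Rightarrow> edges \<Rightarrow> real" where
  "susceptibility n E = (\<Sum>k = 1..n. real k * real (vertices_in_size n E k) / real n)"

text \<open>
  In the next two definitions \<open>v j\<close> (with \<open>1 \<le> j \<le> 2 * r\<close>) is the \<open>j\<close>-th of the vertices offered
  in a step.  Because of \<open>LEAST\<close>, ties are broken in favour of the smallest index.
\<close>

definition sum_rule_index :: "nat \<Rightarrow> edges \<Rightarrow> (nat \<Rightarrow> nat) \<Rightarrow> nat" where
  "sum_rule_index r E v =
     (let c = (\<lambda>j. card (component E (v j)))
      in LEAST j. j \<in> {1..r} \<and>
           (\<forall>l\<in>{1..r}. c (2 * j - 1) + c (2 * j) \<le> c (2 * l - 1) + c (2 * l)))"

definition sum_rule_pair :: "nat \<Rightarrow> edges \<Rightarrow> (nat \<Rightarrow> nat) \<Rightarrow> nat set" where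
  "sum_rule_pair r E v =
     (let j = sum_rule_index r E v in {v (2 * j - 1), v (2 * j)})"

text \<open>
  \<open>\<omega> (i, j)\<close> is the \<open>j\<close>-th vertex chosen in step \<open>i\<close>; steps are numbered from 1.
  The \<open>n/2\<close> initial steps are rounded down to \<open>n div 2\<close>.
\<close>

primrec D_graph :: "nat \<Rightarrow> nat \<Rightarrow> (nat \<times> nat \<Rightarrow> nat) \<Rightarrow> nat \<Rightarrow> edges" where
  "D_graph r n \<omega> 0 = {}"
| "D_graph r n \<omega> (Suc i) =
     insert
       (if Suc i \<le> n div 2 then {\<omega> (Suc i, 1), \<omega> (Suc i, 2)}
        else sum_rule_pair r (D_graph r n \<omega> i) (\<lambda>j. \<omega> (Suc i, j)))
       (D_graph r n \<omega> i)"

definition choices :: "nat \<Rightarrow> nat \<Rightarrow> (nat \<times> nat \<Rightarrow> nat) measure" where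
  "choices r n = Pi\<^sub>M ({1..} \<times> {1..2 * r}) (\<lambda>_. uniform_count_measure {1..n})"

text \<open>
  Convergence in probability for real random variables \<open>X n\<close> on probability spaces \<open>M n\<close> that may
  vary with \<open>n\<close>.  Measurability is required since \<open>measure\<close> is 0 on non-measurable sets.
\<close>

definition tendsto_in_prob ::
    "(nat \<Rightarrow> 'a measure) \<Rightarrow> (nat \<Rightarrow> 'a \<Rightarrow> real) \<Rightarrow> real \<Rightarrow> bool" where
  "tendsto_in_prob M X c \<longleftrightarrow>
     (\<forall>n. X n \<in> borel_measurable (M n)) \<and>
     (\<forall>\<epsilon>>0. (\<lambda>n. \<P>(\<omega> in M n. \<bar>X n \<omega> - c\<bar> > \<epsilon>)) \<longlonglongrightarrow> 0)"

definition tendsto_infinity_in_prob ::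
    "(nat \<Rightarrow> 'a measure) \<Rightarrow> (nat \<Rightarrow> 'a \<Rightarrow> real) \<Rightarrow> bool" where
  "tendsto_infinity_in_prob M X \<longleftrightarrow>
     (\<forall>n. X n \<in> borel_measurable (M n)) \<and>
     (\<forall>C>0. (\<lambda>n. \<P>(\<omega> in M n. X n \<omega> \<le> C)) \<longlonglongrightarrow> 0)"

end

theory Submission
  imports Defs
begin

text \<open>
  After \<open>n div 2\<close> uniformly random edges the graph is critical, and the proportion of vertices in
  components of size at least \<open>k\<close> is of order \<open>k powr (-1/2)\<close>.  Such a tail has infinite mean in
  the limit, so the susceptibility is unbounded.  The tail is however still so thin that the sum rule
  keeps it of the same order for a further linear number of steps, and then no component can be
  linearly large.

  The second half rests on a comparison of exponents.  Let \<open>x\<^sub>k\<close> be the proportion of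
  vertices in components of size at least \<open>k\<close>.  One edge changes \<open>n x\<^sub>k\<close> by at most \<open>2k\<close>, and
  under the sum rule only if in each of the \<open>r\<close> offered pairs the sizes add up to at least \<open>k\<close>.
  Each pair then meets a component of size at least \<open>k/2\<close>, so already the first three pairs show that
  the probability is \<open>O(x\<^sub>k\<^sub>/\<^sub>2 ^ 3)\<close> (\<open>all_pairs_fraction\<close>).  If the tail is of order
  \<open>k powr (-1/2)\<close>, the growth rate of \<open>x\<^sub>k\<close> is thus of order
  \<open>k * k powr (-3/2) = k powr (-1/2)\<close>, the order of the tail itself, and a small enough \<open>\<delta>\<close>
  lets the tail grow at most by a constant factor.  This is where three pairs, and not just two, are
  needed.  Since \<open>x\<^sub>k\<close> is driven by the tail at a smaller size only, the argument is an induction over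
  the sizes \<open>k = 4 ^ j\<close> (\<open>late_tail\<close>), and no differential equation has to be solved.  Each level
  costs an exponential Markov bound (\<open>sum_rule_growth\<close>).

  For the first half, let \<open>f s\<close> be the average of \<open>exp (-s |C(v)|)\<close> over all vertices \<open>v\<close>, where
  \<open>C(v)\<close> is the component of \<open>v\<close>.  In the time \<open>\<tau> = (number of steps) / n\<close> the function
  \<open>w = 1 - f\<close> follows, up to small errors, the Burgers equation \<open>dw/d\<tau> = 2 w dw/ds\<close>, whose
  characteristics are straight lines: \<open>w\<close> stays at the value \<open>u = 1 - exp (-\<sigma>)\<close> that it has at
  \<open>s = \<sigma>\<close>, \<open>\<tau> = 0\<close> if \<open>s\<close> moves as \<open>\<sigma> - 2 u \<tau>\<close>.  The squared deviation from \<open>u\<close> along such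
  a line grows in expectation at most by a factor \<open>1 + O(1/n)\<close> and a term \<open>O(1/n^2)\<close> per step
  (\<open>random_edge_second_moment\<close>), hence stays \<open>O(1/n)\<close> (\<open>critical_transform_concentration\<close>).
  At \<open>\<tau> = 1/2\<close> the line has reached \<open>s = \<sigma> - u\<close>, which is of order \<open>\<sigma>^2\<close>, so \<open>w\<close> is of order
  \<open>sqrt s\<close>.  An upper bound on \<open>w\<close> bounds the tail (\<open>critical_tail\<close>), a lower bound makes
  the susceptibility, which is at least \<open>w / s\<close>, large (\<open>critical_susceptibility\<close>).
\<close>

section \<open>The process as a Markov chain on graphs\<close>

definition next_graph :: "nat \<Rightarrow> nat \<Rightarrow> nat \<Rightarrow> edges \<Rightarrow> (nat \<Rightarrow> nat) \<Rightarrow> edges" where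
  "next_graph r n i E v =
     insert (if Suc i \<le> n div 2 then {v 1, v 2} else sum_rule_pair r E v) E"

text \<open>
  The \<open>2 * r\<close> vertices of a single step, as functions that are \<open>undefined\<close> off their index set, so
  that there are exactly \<open>n ^ (2 * r)\<close> of them.
\<close>

definition offers :: "nat \<Rightarrow> nat \<Rightarrow> (nat \<Rightarrow> nat) set" where
  "offers r n = PiE {1..2 * r} (\<lambda>_. {1..n})"

text \<open>
  The law of the graph \<open>m\<close> steps after it was \<open>E\<close> at time \<open>i\<close>.  Starting at an arbitrary graph and time
  makes it possible to restart the chain at time \<open>n div 2\<close> and condition on the critical graph there.
\<close>

primrec graph_pmf :: "nat \<Rightarrow> nat \<Rightarrow> nat \<Rightarrow> edges \<Rightarrow> nat \<Rightarrow> edges pmf" where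
  "graph_pmf r n i E 0 = return_pmf E"
| "graph_pmf r n i E (Suc m) =
     graph_pmf r n i E m \<bind> (\<lambda>E'. map_pmf (next_graph r n (i + m) E') (pmf_of_set (offers r n)))"

lemma finite_offers: "finite (offers r n)"
  unfolding offers_def by (intro finite_PiE) auto

lemma offers_nonempty: "n > 0 \<Longrightarrow> offers r n \<noteq> {}"
  unfolding offers_def by (auto simp: PiE_eq_empty_iff)

lemma card_offers: "card (offers r n) = n ^ (2 * r)"
  unfolding offers_def by (simp add: card_PiE)

text \<open>
  The \<open>LEAST\<close> in the rule has a witness only for \<open>r > 0\<close>, since the minimum is over \<open>{1..r}\<close>.
\<close>

lemma sum_rule_index_properties:
  fixes v :: "nat \<Rightarrow> nat" and E :: edges
  assumes "r > 0"
  defines "j \<equiv> sum_rule_index r E v"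
  shows "j \<in> {1..r}"
    and "l \<in> {1..r} \<Longrightarrow>
      card (component E (v (2 * j - 1))) + card (component E (v (2 * j)))
      \<le> card (component E (v (2 * l - 1))) + card (component E (v (2 * l)))"
proof -
  define f where "f = (\<lambda>j. card (component E (v (2 * j - 1))) + card (component E (v (2 * j))))"
  have "finite {1..r}" "{1..r} \<noteq> {}" using assms by auto
  then obtain j0 where j0: "j0 \<in> {1..r}" "\<forall>l\<in>{1..r}. f j0 \<le> f l"
    using arg_min_if_finite[of "{1..r}" f] by (metis linorder_not_less)
  have "j \<in> {1..r} \<and> (\<forall>l\<in>{1..r}. f j \<le> f l)"
    unfolding j_def sum_rule_index_def Let_def f_def
    by (rule LeastI[of _ j0]) (use j0 in \<open>auto simp: f_def\<close>)
  then show "j \<in> {1..r}"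
    and "l \<in> {1..r} \<Longrightarrow>
      card (component E (v (2 * j - 1))) + card (component E (v (2 * j)))
      \<le> card (component E (v (2 * l - 1))) + card (component E (v (2 * l)))"
    by (auto simp: f_def)
qed

lemma next_graph_cong:
  assumes "r > 0" and eq: "\<And>j. j \<in> {1..2 * r} \<Longrightarrow> v j = w j"
  shows "next_graph r n i E v = next_graph r n i E w"
proof -
  have eq': "v (2 * j - 1) = w (2 * j - 1)" "v (2 * j) = w (2 * j)" if "j \<in> {1..r}" for j
    using that by (auto intro!: eq)
  have "sum_rule_index r E v = sum_rule_index r E w"
    unfolding sum_rule_index_def Let_def
    by (intro arg_cong[where f = Least] ext conj_cong ball_cong refl) (auto simp: eq'[unfolded One_nat_def])
  moreover have "v 1 = w 1" "v 2 = w 2" using assms(1) by (auto intro!: eq)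
  ultimately show ?thesis
    using eq'[OF sum_rule_index_properties(1)[OF assms(1)]]
    by (simp add: next_graph_def sum_rule_pair_def Let_def)
qed

lemma D_graph_Suc:
  "D_graph r n \<omega> (Suc i) = next_graph r n i (D_graph r n \<omega> i) (\<lambda>j. \<omega> (Suc i, j))"
  by (simp add: next_graph_def)

lemma D_graph_cong:
  assumes "r > 0"
    and "\<And>i' j. i' \<in> {1..i} \<Longrightarrow> j \<in> {1..2 * r} \<Longrightarrow> \<omega> (i', j) = \<omega>' (i', j)"
  shows "D_graph r n \<omega> i = D_graph r n \<omega>' i"
  using assms(2)
proof (induction i)
  case (Suc i)
  then have "D_graph r n \<omega> i = D_graph r n \<omega>' i" by auto
  then show ?case
    unfolding D_graph_Suc using Suc.prems by (auto intro!: next_graph_cong[OF assms(1)])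
qed simp

abbreviation history :: "nat \<Rightarrow> nat \<Rightarrow> (nat \<times> nat) set" where
  "history r i \<equiv> {1..i} \<times> {1..2 * r}"

lemma D_graph_restrict:
  "r > 0 \<Longrightarrow> D_graph r n (restrict \<omega> (history r i)) i = D_graph r n \<omega> i"
  by (rule D_graph_cong) auto

text \<open>
  Finitely many choices form a finite discrete space.  All measurability questions about the process
  reduce to this, because the graph after \<open>i\<close> steps depends on finitely many choices.
\<close>

lemma sets_PiM_uniform_count_measure:
  assumes "finite A"
  shows "sets (PiM A (\<lambda>_. uniform_count_measure {1..n::nat})) = Pow (PiE A (\<lambda>_. {1..n}))"
proof
  let ?M = "PiM A (\<lambda>_. uniform_count_measure {1..n})"
  have sp: "space ?M = PiE A (\<lambda>_. {1..n})"
    by (simp add: space_PiM space_uniform_count_measure)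
  show "sets ?M \<subseteq> Pow (PiE A (\<lambda>_. {1..n}))"
    using sets.space_closed[of ?M] sp by simp
  have single: "{h} \<in> sets ?M" if "h \<in> PiE A (\<lambda>_. {1..n})" for h
  proof -
    have "PiE A (\<lambda>a. {h a}) \<in> sets ?M"
      using that assms by (intro sets_PiM_I_finite) (auto simp: sets_uniform_count_measure)
    also have "PiE A (\<lambda>a. {h a}) = {h}"
      using that by (intro PiE_singleton) (simp add: PiE_def)
    finally show ?thesis .
  qed
  show "Pow (PiE A (\<lambda>_. {1..n})) \<subseteq> sets ?M"
  proof
    fix X assume X: "X \<in> Pow (PiE A (\<lambda>_. {1..n}))"
    then have "finite X"
      using assms by (meson PowD finite_PiE finite_atLeastAtMost finite_subset)
    moreover have "{h} \<in> sets ?M" if "h \<in> X" for h using that X single by auto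
    ultimately have "(\<Union>h\<in>X. {h}) \<in> sets ?M" by (intro sets.finite_UN) auto
    then show "X \<in> sets ?M" by simp
  qed
qed

lemma D_graph_measurable:
  assumes "r > 0"
  shows "(\<lambda>\<omega>. D_graph r n \<omega> i) \<in> measurable (choices r n) (count_space UNIV)"
proof -
  let ?A = "history r i"
  let ?M = "PiM ?A (\<lambda>_. uniform_count_measure {1..n})"
  have "(\<lambda>h. D_graph r n h i) \<in> measurable ?M (count_space UNIV)"
    unfolding measurable_def
    by (subst sets_PiM_uniform_count_measure) (auto simp: space_PiM space_uniform_count_measure)
  moreover have "(\<lambda>\<omega>. restrict \<omega> ?A) \<in> measurable (choices r n) ?M"
    unfolding choices_def by (rule measurable_restrict_subset) auto
  ultimately have "(\<lambda>\<omega>. D_graph r n (restrict \<omega> ?A) i) \<in> measurable (choices r n) (count_space UNIV)"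
    by (rule measurable_compose[rotated])
  then show ?thesis by (simp only: D_graph_restrict[OF assms])
qed

lemma D_graph_functional_measurable:
  fixes f :: "edges \<Rightarrow> real"
  assumes "r > 0"
  shows "(\<lambda>\<omega>. f (D_graph r n \<omega> i)) \<in> borel_measurable (choices r n)"
  by (rule measurable_compose[OF D_graph_measurable[OF assms]]) simp

text \<open>
  The Markov property of the process.  The graph after \<open>i\<close> steps is a function of the choices with
  first index in \<open>{1..i}\<close>; those with first index \<open>Suc i\<close> are independent of them and uniform.
\<close>

lemma prob_D_graph_Suc:
  assumes "r > 0" "n > 0"
  shows "\<P>(\<omega> in choices r n. Q (D_graph r n \<omega> (Suc i))) =
    (\<Sum>v\<in>offers r n. \<P>(\<omega> in choices r n. Q (next_graph r n i (D_graph r n \<omega> i) v)) / real n ^ (2 * r))"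
proof -
  let ?U = "\<lambda>_::nat\<times>nat. uniform_count_measure {1..n}"
  let ?I = "{1..} \<times> {1..2 * r}"
  let ?A = "history r i" and ?B = "{Suc i} \<times> {1..2 * r}"
  have U: "prob_space (uniform_count_measure {1..n})"
    using assms by (intro prob_space_uniform_count_measure) auto
  interpret product_prob_space ?U ?I
    using U by (intro product_prob_spaceI)
  have M: "choices r n = PiM ?I ?U" by (simp add: choices_def)
  have "indep_vars ?U (\<lambda>k \<omega>. \<omega> k) ?I"
  proof (subst P.indep_vars_iff_distr_eq_PiM')
    show "distr (PiM ?I ?U) (PiM ?I ?U) (\<lambda>x. \<lambda>i\<in>?I. x i) = PiM ?I (\<lambda>i. distr (PiM ?I ?U) (?U i) (\<lambda>\<omega>. \<omega> i))"
    proof -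
      have "distr (PiM ?I ?U) (PiM ?I ?U) (\<lambda>x. \<lambda>i\<in>?I. x i) = distr (PiM ?I ?U) (PiM ?I ?U) (\<lambda>x. x)"
        by (intro distr_cong refl) (auto simp: space_PiM PiE_def extensional_restrict)
      also have "\<dots> = PiM ?I ?U" by (simp add: distr_id)
      also have "\<dots> = PiM ?I (\<lambda>i. distr (PiM ?I ?U) (?U i) (\<lambda>\<omega>. \<omega> i))"
        by (intro PiM_cong refl) (rule PiM_component[symmetric])
      finally show ?thesis .
    qed
  qed (use assms in auto)
  then have ind: "indep_var (PiM ?A ?U) (\<lambda>\<omega>. restrict (\<lambda>k. \<omega> k) ?A) (PiM ?B ?U) (\<lambda>\<omega>. restrict (\<lambda>k. \<omega> k) ?B)"
    by (rule P.indep_var_restrict) auto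
  let ?Y = "\<lambda>\<omega>. \<lambda>j\<in>{1..2*r}. \<omega> (Suc i, j)"
  let ?X = "\<lambda>v. {\<omega> \<in> space (choices r n). Q (next_graph r n i (D_graph r n \<omega> i) v)}"
  let ?Z = "\<lambda>v. {\<omega> \<in> space (choices r n). ?Y \<omega> = v}"
  have one: "measure (choices r n) (?X v \<inter> ?Z v) = measure (choices r n) (?X v) / real n ^ (2 * r)"
    and mble: "?X v \<inter> ?Z v \<in> sets (choices r n)" if v: "v \<in> offers r n" for v
  proof -
    let ?w = "\<lambda>k\<in>?B. v (snd k)"
    let ?SA = "{h \<in> PiE ?A (\<lambda>_. {1..n}). Q (next_graph r n i (D_graph r n h i) v)}"
    let ?SB = "{?w}"
    have w: "?w \<in> PiE ?B (\<lambda>_. {1..n})" using v by (auto simp: offers_def)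
    have wk: "?w k \<in> {1..n}" if "k \<in> ?B" for k using w that by (rule PiE_mem)
    have SA: "?SA \<in> sets (PiM ?A ?U)" by (subst sets_PiM_uniform_count_measure) auto
    have SB: "?SB \<in> sets (PiM ?B ?U)" using w by (subst sets_PiM_uniform_count_measure) auto
    have Xeq: "?X v = (\<lambda>\<omega>. restrict \<omega> ?A) -` ?SA \<inter> space (choices r n)"
    proof -
      have "restrict \<omega> ?A \<in> PiE ?A (\<lambda>_. {1..n})" if "\<omega> \<in> space (choices r n)" for \<omega>
        using that by (auto simp: choices_def space_PiM space_uniform_count_measure)
      then show ?thesis
        by (auto simp only: D_graph_restrict[OF assms(1)] vimage_eq mem_Collect_eq Int_iff)
    qed
    have Zeq: "?Z v = (\<lambda>\<omega>. restrict \<omega> ?B) -` ?SB \<inter> space (choices r n)"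
    proof -
      have "(?Y \<omega> = v) = (restrict \<omega> ?B = ?w)" for \<omega>
      proof -
        have "(?Y \<omega> = v) = (\<forall>j\<in>{1..2*r}. \<omega> (Suc i, j) = v j)"
          using v unfolding offers_def PiE_def extensional_def restrict_def fun_eq_iff by auto
        also have "\<dots> = (restrict \<omega> ?B = ?w)"
          unfolding restrict_def fun_eq_iff by auto
        finally show ?thesis .
      qed
      then show ?thesis by auto
    qed
    have "?X v \<inter> ?Z v = (\<lambda>\<omega>. (restrict \<omega> ?A, restrict \<omega> ?B)) -` (?SA \<times> ?SB) \<inter> space (choices r n)"
      unfolding Xeq Zeq by blast
    then have prod: "measure (choices r n) (?X v \<inter> ?Z v) = measure (choices r n) (?X v) * measure (choices r n) (?Z v)"
      using P.indep_varD[OF ind SA SB] Xeq Zeq M by simp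
    have "?Z v = prod_emb ?I ?U ?B (PiE ?B (\<lambda>k. {?w k}))"
    proof -
      have "PiE ?B (\<lambda>k. {?w k}) = {?w}"
        by (intro PiE_singleton restrict_extensional)
      then show ?thesis unfolding Zeq by (simp add: M space_PiM prod_emb_def)
    qed
    then have "measure (choices r n) (?Z v) = measure (choices r n) (prod_emb ?I ?U ?B (PiE ?B (\<lambda>k. {?w k})))"
      by simp
    also have "\<dots> = (\<Prod>k\<in>?B. measure (?U k) {?w k})"
      unfolding M
    proof (intro measure_PiM_emb)
      show "{?w k} \<in> sets (?U k)" if "k \<in> ?B" for k
        using wk[OF that] unfolding sets_uniform_count_measure by blast
    qed auto
    also have "\<dots> = (\<Prod>k\<in>?B. 1 / n)"
    proof (intro prod.cong refl)
      show "measure (?U k) {?w k} = 1 / n" if "k \<in> ?B" for k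
        using wk[OF that] by (subst measure_uniform_count_measure) (blast, blast, simp)
    qed
    also have "\<dots> = 1 / real n ^ (2 * r)" by (simp add: power_one_over card_cartesian_product)
    finally show "measure (choices r n) (?X v \<inter> ?Z v) = measure (choices r n) (?X v) / real n ^ (2 * r)"
      unfolding prod by simp
    have "(\<lambda>\<omega>. restrict \<omega> ?A) \<in> measurable (choices r n) (PiM ?A ?U)"
         "(\<lambda>\<omega>. restrict \<omega> ?B) \<in> measurable (choices r n) (PiM ?B ?U)"
      unfolding choices_def by (rule measurable_restrict_subset, auto)+
    then show "?X v \<inter> ?Z v \<in> sets (choices r n)"
      unfolding Xeq Zeq using SA SB by (intro sets.Int measurable_sets)
  qed
  have "{\<omega> \<in> space (choices r n). Q (D_graph r n \<omega> (Suc i))} = (\<Union>v\<in>offers r n. ?X v \<inter> ?Z v)"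
  proof -
    have "?Y \<omega> \<in> offers r n" if "\<omega> \<in> space (choices r n)" for \<omega>
      using that by (auto simp: offers_def choices_def space_PiM space_uniform_count_measure)
    moreover have "D_graph r n \<omega> (Suc i) = next_graph r n i (D_graph r n \<omega> i) (?Y \<omega>)" for \<omega>
      unfolding D_graph_Suc using assms by (intro next_graph_cong) auto
    ultimately show ?thesis by auto
  qed
  then have "\<P>(\<omega> in choices r n. Q (D_graph r n \<omega> (Suc i))) = measure (choices r n) (\<Union>v\<in>offers r n. ?X v \<inter> ?Z v)"
    by simp
  also have "\<dots> = (\<Sum>v\<in>offers r n. measure (choices r n) (?X v \<inter> ?Z v))"
    using mble unfolding M
    by (intro P.finite_measure_finite_Union) (auto simp: finite_offers disjoint_family_on_def)
  also have "\<dots> = (\<Sum>v\<in>offers r n. measure (choices r n) (?X v) / real n ^ (2 * r))"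
    using one by simp
  finally show ?thesis .
qed

lemma finite_set_graph_pmf:
  "n > 0 \<Longrightarrow> finite (set_pmf (graph_pmf r n i E m))"
  by (induction m) (auto simp: finite_offers offers_nonempty)

lemma expectation_bind_finite:
  fixes h :: "'b \<Rightarrow> real"
  assumes "finite (set_pmf p)" "\<And>x. x \<in> set_pmf p \<Longrightarrow> finite (set_pmf (f x))"
  shows "measure_pmf.expectation (p \<bind> f) h =
    measure_pmf.expectation p (\<lambda>x. measure_pmf.expectation (f x) h)"
  using assms
  by (subst pmf_expectation_bind[of "set_pmf p"]) (auto simp: integral_measure_pmf[of "set_pmf p"] mult.commute)

lemma expectation_graph_pmf_Suc:
  fixes h :: "edges \<Rightarrow> real"
  assumes "n > 0"
  shows "measure_pmf.expectation (graph_pmf r n i E (Suc m)) h =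
    measure_pmf.expectation (graph_pmf r n i E m)
      (\<lambda>E'. (\<Sum>v\<in>offers r n. h (next_graph r n (i + m) E' v)) / real n ^ (2 * r))"
  unfolding graph_pmf.simps
  by (subst expectation_bind_finite)
     (auto simp: assms finite_set_graph_pmf finite_offers offers_nonempty integral_pmf_of_set card_offers)

lemma prob_eq_expectation_indicator:
  "measure_pmf.prob p {x. Q x} = measure_pmf.expectation p (\<lambda>x. indicator {x. Q x} x :: real)"
  by simp

text \<open>
  From here on the infinite product space is replaced by the finitely supported law \<open>graph_pmf\<close>.
\<close>

lemma prob_D_graph:
  assumes "r > 0" "n > 0"
  shows "\<P>(\<omega> in choices r n. Q (D_graph r n \<omega> i)) = measure_pmf.prob (graph_pmf r n 0 {} i) {E. Q E}"
proof (induction i arbitrary: Q)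
  case 0
  interpret prob_space "choices r n"
    unfolding choices_def using assms
    by (intro prob_space_PiM prob_space_uniform_count_measure) auto
  show ?case using prob_space by (cases "Q {}") (auto simp: measure_return_pmf)
next
  case (Suc i)
  let ?p = "graph_pmf r n 0 {} i"
  have "measure_pmf.prob (graph_pmf r n 0 {} (Suc i)) {E. Q E} =
      measure_pmf.expectation ?p
      (\<lambda>E'. \<Sum>v\<in>offers r n. indicator {E. Q E} (next_graph r n (0 + i) E' v) / real n ^ (2 * r))"
    unfolding prob_eq_expectation_indicator
    by (subst expectation_graph_pmf_Suc[OF assms(2)]) (simp add: sum_divide_distrib)
  also have "\<dots> = (\<Sum>v\<in>offers r n. measure_pmf.expectation ?p
       (\<lambda>E'. indicator {E. Q E} (next_graph r n i E' v) / real n ^ (2 * r)))"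
    by (subst Bochner_Integration.integral_sum)
       (auto intro!: integrable_measure_pmf_finite finite_set_graph_pmf assms)
  also have "\<dots> = (\<Sum>v\<in>offers r n. measure_pmf.prob ?p {E. Q (next_graph r n i E v)} / real n ^ (2 * r))"
  proof -
    have "indicator {E. Q E} (next_graph r n i E' v) =
        (indicator {E. Q (next_graph r n i E v)} E' :: real)" for E' v
      by (simp add: indicator_def)
    then show ?thesis by simp
  qed
  also have "\<dots> = \<P>(\<omega> in choices r n. Q (D_graph r n \<omega> (Suc i)))"
    unfolding prob_D_graph_Suc[OF assms] by (intro sum.cong refl) (subst Suc.IH, rule refl)
  finally show ?case by simp
qed

section \<open>Components and the effect of one new edge\<close>

abbreviation csize :: "edges \<Rightarrow> nat \<Rightarrow> nat" where
  "csize E v \<equiv> card (component E v)"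

definition edges_on :: "nat \<Rightarrow> edges \<Rightarrow> bool" where
  "edges_on n E \<longleftrightarrow> (\<forall>e\<in>E. e \<subseteq> {1..n})"

lemma edges_on_empty: "edges_on n {}" by (simp add: edges_on_def)

lemma edges_on_insert:
  "edges_on n (insert {a, b} E) \<longleftrightarrow> a \<in> {1..n} \<and> b \<in> {1..n} \<and> edges_on n E"
  by (auto simp: edges_on_def)

lemma component_refl: "v \<in> component E v"
  by (simp add: component_def)

lemma component_sym:
  assumes "w \<in> component E v"
  shows "v \<in> component E w"
proof -
  have "sym {(x, y). {x, y} \<in> E}" by (auto simp: sym_def insert_commute)
  then have "sym ({(x, y). {x, y} \<in> E}\<^sup>*)" by (rule sym_rtrancl)
  then show ?thesis using assms by (auto simp: component_def dest: symD)
qed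

lemma component_trans: "w \<in> component E v \<Longrightarrow> u \<in> component E w \<Longrightarrow> u \<in> component E v"
  unfolding component_def by (auto intro: rtrancl_trans)

lemma component_eq: "w \<in> component E v \<Longrightarrow> component E w = component E v"
  by (blast intro: component_sym component_trans)

lemma component_mono: "E \<subseteq> F \<Longrightarrow> component E v \<subseteq> component F v"
  unfolding component_def using rtrancl_mono[of "{(x, y). {x, y} \<in> E}" "{(x, y). {x, y} \<in> F}"] by auto

lemma component_induct [consumes 1, case_names refl step]:
  assumes "w \<in> component E v" "P v"
    and "\<And>x y. x \<in> component E v \<Longrightarrow> {x, y} \<in> E \<Longrightarrow> P x \<Longrightarrow> P y"
  shows "P w"
proof -
  have "(v, w) \<in> {(x, y). {x, y} \<in> E}\<^sup>*" using assms(1) by (simp add: component_def)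
  then show ?thesis
  proof (induction rule: rtrancl_induct)
    case base
    show ?case by (rule assms(2))
  next
    case (step x y)
    then show ?case by (intro assms(3)[of x y]) (auto simp: component_def)
  qed
qed

lemma component_edge: "{x, y} \<in> E \<Longrightarrow> y \<in> component E x"
  unfolding component_def by auto

lemma component_insert:
  "component (insert {a, b} E) v =
     (if v \<in> component E a \<union> component E b then component E a \<union> component E b
      else component E v)"
proof (cases "v \<in> component E a \<union> component E b")
  case True
  let ?U = "component E a \<union> component E b" and ?F = "insert {a, b} E"
  have mono: "component E x \<subseteq> component ?F x" for x by (rule component_mono) auto
  have ab: "component ?F a = component ?F b"
    by (rule component_eq[symmetric]) (simp add: component_edge)
  have "v \<in> component ?F a" using True mono[of a] mono[of b] ab by auto
  then have "component ?F v = component ?F a" by (rule component_eq)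
  then have "?U \<subseteq> component ?F v" using mono[of a] mono[of b] ab by auto
  moreover have "component ?F v \<subseteq> ?U"
  proof
    fix w assume "w \<in> component ?F v"
    then show "w \<in> ?U"
    proof (induction rule: component_induct)
      case (step x y)
      show ?case
      proof (cases "{x, y} = {a, b}")
        case True
        then show ?thesis using component_refl by (auto simp: doubleton_eq_iff)
      next
        case False
        then have "y \<in> component E x" using step(2) by (intro component_edge) simp
        then show ?thesis using step(3) component_trans by blast
      qed
    qed (use True in auto)
  qed
  ultimately have "component ?F v = ?U" by (rule equalityI[rotated])
  then show ?thesis using True by (simp only: if_True)
next
  case False
  let ?F = "insert {a, b} E"
  have "component ?F v \<subseteq> component E v"
  proof
    fix w assume "w \<in> component ?F v"
    then show "w \<in> component E v"
    proof (induction rule: component_induct)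
      case (step x y)
      have "{x, y} \<noteq> {a, b}"
        using False step(3) by (auto simp: doubleton_eq_iff dest: component_sym)
      then have "y \<in> component E x" using step(2) by (intro component_edge) simp
      then show ?case using step(3) component_trans by blast
    qed (rule component_refl)
  qed
  moreover have "component E v \<subseteq> component ?F v" by (rule component_mono) auto
  ultimately show ?thesis using False by auto
qed

lemma component_subset:
  assumes "edges_on n E" "v \<in> {1..n}"
  shows "component E v \<subseteq> {1..n}"
proof
  fix w assume "w \<in> component E v"
  then show "w \<in> {1..n}"
  proof (induction rule: component_induct)
    case (step x y)
    then have "{x, y} \<subseteq> {1..n}" using assms(1) unfolding edges_on_def by (rule_tac bspec)
    then show ?case by (rule subsetD) simp
  qed (rule assms(2))
qed

lemma finite_component: "edges_on n E \<Longrightarrow> v \<in> {1..n} \<Longrightarrow> finite (component E v)"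
  by (rule finite_subset[OF component_subset]) auto

lemma csize_bounds:
  assumes "edges_on n E" "v \<in> {1..n}"
  shows "1 \<le> csize E v" "csize E v \<le> n"
proof -
  show "1 \<le> csize E v"
    using finite_component[OF assms] component_refl[of v E]
    by (metis One_nat_def Suc_leI card_gt_0_iff empty_iff)
  show "csize E v \<le> n"
    using card_mono[OF finite_atLeastAtMost component_subset[OF assms]] by simp
qed

text \<open>
  Both quantities of interest are of this form: \<open>g = real\<close> gives \<open>n\<close> times the susceptibility, and
  the indicator of \<open>k \<le> c\<close> counts the vertices in components of size at least \<open>k\<close>.
\<close>

definition size_sum :: "nat \<Rightarrow> edges \<Rightarrow> (nat \<Rightarrow> real) \<Rightarrow> real" where
  "size_sum n E g = (\<Sum>v\<in>{1..n}. g (csize E v))"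

lemma size_sum_mono:
  assumes "edges_on n E" "\<And>c. 1 \<le> c \<Longrightarrow> c \<le> n \<Longrightarrow> g c \<le> h c"
  shows "size_sum n E g \<le> size_sum n E h"
  unfolding size_sum_def using assms csize_bounds[OF assms(1)] by (intro sum_mono) auto

lemma sum_component: "(\<Sum>v\<in>component E a. g (csize E v)) = real (csize E a) * g (csize E a)"
proof -
  have "(\<Sum>v\<in>component E a. g (csize E v)) = (\<Sum>v\<in>component E a. g (csize E a))"
    by (intro sum.cong refl) (simp add: component_eq[where v = a])
  then show ?thesis by simp
qed

text \<open>
  Only the vertices in the two components that are joined change their component size.
\<close>

lemma size_sum_insert:
  assumes E: "edges_on n E" and a: "a \<in> {1..n}" and b: "b \<in> {1..n}"
  shows "size_sum n (insert {a, b} E) g =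
    size_sum n E g +
    (if b \<in> component E a then 0
     else real (csize E a + csize E b) * g (csize E a + csize E b)
        - real (csize E a) * g (csize E a) - real (csize E b) * g (csize E b))"
proof (cases "b \<in> component E a")
  case True
  then have "component E b = component E a" by (rule component_eq)
  then have "component (insert {a, b} E) v = component E v" for v
    by (auto simp: component_insert dest: component_eq)
  then show ?thesis using True by (simp add: size_sum_def)
next
  case False
  let ?A = "component E a" and ?B = "component E b"
  have disj: "?A \<inter> ?B = {}"
    using False by (metis component_eq component_refl disjoint_iff)
  have fin: "finite ?A" "finite ?B" using finite_component E a b by auto
  have sub: "?A \<union> ?B \<subseteq> {1..n}" using component_subset[OF E] a b by auto
  have cU: "card (?A \<union> ?B) = csize E a + csize E b"
    using disj fin by (simp add: card_Un_disjoint)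
  have split: "size_sum n F g = (\<Sum>v\<in>{1..n} - (?A \<union> ?B). g (csize F v)) + (\<Sum>v\<in>?A \<union> ?B. g (csize F v))" for F
    unfolding size_sum_def using sub by (intro sum.subset_diff) auto
  have "size_sum n (insert {a, b} E) g =
     (\<Sum>v\<in>{1..n} - (?A \<union> ?B). g (csize E v)) + (\<Sum>v\<in>?A \<union> ?B. g (card (?A \<union> ?B)))"
    unfolding split[of "insert {a, b} E"]
    by (intro arg_cong2[where f = "(+)"] sum.cong refl) (auto simp: component_insert)
  moreover have "size_sum n E g =
     (\<Sum>v\<in>{1..n} - (?A \<union> ?B). g (csize E v)) +
     (real (csize E a) * g (csize E a) + real (csize E b) * g (csize E b))"
    unfolding split[of E] using disj fin by (simp add: sum.union_disjoint sum_component)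
  ultimately show ?thesis using False cU by simp
qed

definition vertices_ge :: "nat \<Rightarrow> edges \<Rightarrow> nat \<Rightarrow> nat" where
  "vertices_ge n E k = card {v \<in> {1..n}. k \<le> csize E v}"

lemma vertices_ge_eq_size_sum: "real (vertices_ge n E k) = size_sum n E (\<lambda>c. of_bool (k \<le> c))"
  by (simp add: vertices_ge_def size_sum_def of_bool_def sum.If_cases Int_def)

lemma vertices_ge_le: "vertices_ge n E k \<le> n"
proof -
  have "card {v \<in> {1..n}. k \<le> csize E v} \<le> card {1..n}" by (rule card_mono) auto
  then show ?thesis by (simp add: vertices_ge_def)
qed

text \<open>
  If both components are smaller than \<open>k\<close> and together have size at least \<open>k\<close>, all their fewer than
  \<open>2 * k\<close> vertices are new; if only one of them is smaller than \<open>k\<close>, its vertices are new.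
\<close>

lemma vertices_ge_insert:
  assumes "edges_on n E" "a \<in> {1..n}" "b \<in> {1..n}"
  shows "vertices_ge n E k \<le> vertices_ge n (insert {a, b} E) k"
    and "vertices_ge n (insert {a, b} E) k \<le>
         vertices_ge n E k + (if k \<le> csize E a + csize E b then 2 * k else 0)"
proof -
  note * = size_sum_insert[OF assms, of "\<lambda>c. of_bool (k \<le> c)", folded vertices_ge_eq_size_sum]
  have "real (vertices_ge n E k) \<le> real (vertices_ge n (insert {a, b} E) k)"
    unfolding * by (auto simp: of_bool_def)
  then show "vertices_ge n E k \<le> vertices_ge n (insert {a, b} E) k" by simp
  have "real (vertices_ge n (insert {a, b} E) k) \<le>
      real (vertices_ge n E k) + (if k \<le> csize E a + csize E b then 2 * real k else 0)"
    unfolding * by (auto simp: of_bool_def)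
  then show "vertices_ge n (insert {a, b} E) k \<le>
         vertices_ge n E k + (if k \<le> csize E a + csize E b then 2 * k else 0)"
    by (auto split: if_splits)
qed

text \<open>
  A largest component itself consists of vertices in components of size at least \<open>k\<close>.  So a bound on
  their number by \<open>\<epsilon> * n\<close> for a single fixed \<open>k\<close> bounds \<open>L1\<close> by \<open>\<epsilon> * n\<close> once \<open>n\<close> is large.
\<close>

lemma L1_le_vertices_ge:
  assumes "edges_on n E" "n > 0" "k \<le> L1 n E"
  shows "L1 n E \<le> vertices_ge n E k"
proof -
  have "L1 n E \<in> card ` components n E"
    unfolding L1_def components_def using assms by (intro Max_in) auto
  then obtain v where v: "v \<in> {1..n}" "L1 n E = csize E v"
    by (auto simp: components_def)
  have "component E v \<subseteq> {w \<in> {1..n}. k \<le> csize E w}"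
  proof
    fix w assume w: "w \<in> component E v"
    have "csize E w = csize E v" by (simp only: component_eq[OF w])
    then show "w \<in> {w \<in> {1..n}. k \<le> csize E w}"
      using subsetD[OF component_subset[OF assms(1) v(1)] w] assms(3) v(2) by simp
  qed
  then show ?thesis
    unfolding v(2) vertices_ge_def by (intro card_mono) auto
qed

lemma susceptibility_eq_size_sum:
  assumes "edges_on n E"
  shows "susceptibility n E = size_sum n E real / n"
proof -
  have "size_sum n E real = (\<Sum>k\<in>{1..n}. \<Sum>v\<in>{v \<in> {1..n}. csize E v = k}. real (csize E v))"
    unfolding size_sum_def
    by (rule sum.group[symmetric]) (use csize_bounds[OF assms] in auto)
  also have "\<dots> = (\<Sum>k = 1..n. real k * real (vertices_in_size n E k))"
    by (intro sum.cong refl) (simp add: vertices_in_size_def)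
  finally show ?thesis
    by (simp add: susceptibility_def sum_divide_distrib)
qed

lemma offers_mem: "v \<in> offers r n \<Longrightarrow> j \<in> {1..2 * r} \<Longrightarrow> v j \<in> {1..n}"
  unfolding offers_def by (rule PiE_mem)

lemma sum_rule_pair_vertices:
  assumes "r > 0" "v \<in> offers r n"
  obtains j where "j \<in> {1..r}" "j = sum_rule_index r E v"
    "sum_rule_pair r E v = {v (2 * j - 1), v (2 * j)}"
    "v (2 * j - 1) \<in> {1..n}" "v (2 * j) \<in> {1..n}"
proof -
  let ?j = "sum_rule_index r E v"
  have j: "?j \<in> {1..r}"
    using sum_rule_index_properties(1)[of r E v] assms(1) by simp
  then have "2 * ?j - 1 \<in> {1..2 * r}" "2 * ?j \<in> {1..2 * r}" by auto
  then have "v (2 * ?j - 1) \<in> {1..n}" "v (2 * ?j) \<in> {1..n}"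
    using offers_mem[OF assms(2)] by blast+
  then show thesis using that[of ?j] j by (simp only: sum_rule_pair_def Let_def simp_thms)
qed

lemma edges_on_next_graph:
  assumes "r > 0" "edges_on n E" "v \<in> offers r n"
  shows "edges_on n (next_graph r n i E v)"
proof -
  have "v 1 \<in> {1..n}" "v 2 \<in> {1..n}"
    using offers_mem[OF assms(3), of 1] offers_mem[OF assms(3), of 2] assms(1) by auto
  moreover obtain a b where "sum_rule_pair r E v = {a, b}" "a \<in> {1..n}" "b \<in> {1..n}"
    using sum_rule_pair_vertices[OF assms(1,3), of E] by metis
  ultimately show ?thesis
    using assms(2) by (simp add: next_graph_def edges_on_insert del: atLeastAtMost_iff)
qed

lemma edges_on_graph_pmf:
  assumes "r > 0" "n > 0" "edges_on n E" "F \<in> set_pmf (graph_pmf r n i E m)"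
  shows "edges_on n F"
  using assms(4)
proof (induction m arbitrary: F)
  case (Suc m)
  then obtain E' v where "E' \<in> set_pmf (graph_pmf r n i E m)" "v \<in> offers r n"
      "F = next_graph r n (i + m) E' v"
    using set_pmf_of_set[OF offers_nonempty[OF assms(2)] finite_offers] by auto
  then show ?case using Suc.IH edges_on_next_graph[OF assms(1)] by simp
qed (use assms(3) in simp)

section \<open>Moment bounds along the chain, and averages over one offer\<close>

lemma pmf_markov:
  fixes h :: "'a \<Rightarrow> real"
  assumes "finite (set_pmf p)" "\<And>x. x \<in> set_pmf p \<Longrightarrow> 0 \<le> h x" "t > 0"
  shows "measure_pmf.prob p {x. t \<le> h x} \<le> measure_pmf.expectation p h / t"
proof -
  have "t * measure_pmf.prob p {x. t \<le> h x} = measure_pmf.expectation p (\<lambda>x. t * indicator {x. t \<le> h x} x)"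
    by simp
  also have "\<dots> \<le> measure_pmf.expectation p h"
    using assms by (intro integral_mono_AE integrable_measure_pmf_finite) (auto simp: AE_measure_pmf_iff indicator_def)
  finally show ?thesis using assms(3) by (simp add: field_simps)
qed

text \<open>
  A discrete Gronwall inequality.  It serves both the second moment in the critical phase, where
  \<open>c = 1 + O(1/n)\<close> and \<open>d = O(1/n^2)\<close>, and the exponential moment under the sum rule, where \<open>d = 0\<close>.
  The functional \<open>h j\<close> may depend on the time \<open>j\<close>, as it does when it is followed along a characteristic.
\<close>

lemma expectation_graph_pmf_le:
  fixes h :: "nat \<Rightarrow> edges \<Rightarrow> real"
  assumes r: "r > 0" and n: "n > 0" and E: "edges_on n E" and c: "c \<ge> 1" and d: "d \<ge> 0"
    and step: "\<And>j F. j < m \<Longrightarrow> edges_on n F \<Longrightarrow>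
      (\<Sum>v\<in>offers r n. h (Suc j) (next_graph r n (i + j) F v)) / real n ^ (2 * r) \<le> c * h j F + d"
  shows "measure_pmf.expectation (graph_pmf r n i E m) (h m) \<le> c ^ m * (h 0 E + m * d)"
  using step
proof (induction m)
  case (Suc m)
  let ?p = "graph_pmf r n i E m"
  have fin: "finite (set_pmf ?p)" by (rule finite_set_graph_pmf[OF n])
  have "measure_pmf.expectation (graph_pmf r n i E (Suc m)) (h (Suc m)) =
    measure_pmf.expectation ?p (\<lambda>F. (\<Sum>v\<in>offers r n. h (Suc m) (next_graph r n (i + m) F v)) / real n ^ (2 * r))"
    by (rule expectation_graph_pmf_Suc[OF n])
  also have "\<dots> \<le> measure_pmf.expectation ?p (\<lambda>F. c * h m F + d)"
    using Suc.prems edges_on_graph_pmf[OF r n E]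
    by (intro integral_mono_AE integrable_measure_pmf_finite fin) (simp add: AE_measure_pmf_iff)
  also have "\<dots> = c * measure_pmf.expectation ?p (h m) + d"
    by (simp add: integrable_measure_pmf_finite fin)
  also have "\<dots> \<le> c * (c ^ m * (h 0 E + m * d)) + c ^ Suc m * d"
  proof (intro add_mono mult_left_mono)
    show "measure_pmf.expectation ?p (h m) \<le> c ^ m * (h 0 E + m * d)"
      by (rule Suc.IH) (use Suc.prems in auto)
    have "1 \<le> c ^ Suc m" using c by (rule one_le_power)
    then show "d \<le> c ^ Suc m * d" using mult_right_mono[of 1 "c ^ Suc m" d] d by simp
  qed (use c in auto)
  also have "\<dots> = c ^ Suc m * (h 0 E + Suc m * d)" by (simp add: algebra_simps)
  finally show ?case .
qed simp

lemma offers_fraction: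
  assumes n: "n > 0" and J: "J \<subseteq> {1..2 * r}" and B: "\<And>j. j \<in> J \<Longrightarrow> B j \<subseteq> {1..n}"
  shows "real (card {v \<in> offers r n. \<forall>j\<in>J. v j \<in> B j}) / real n ^ (2 * r) = (\<Prod>j\<in>J. real (card (B j)) / n)"
proof -
  let ?B = "\<lambda>j. if j \<in> J then B j else {1..n}"
  have "v \<in> PiE {1..2 * r} ?B \<longleftrightarrow> v \<in> offers r n \<and> (\<forall>j\<in>J. v j \<in> B j)" for v
  proof -
    have "(\<forall>j\<in>{1..2 * r}. v j \<in> ?B j) \<longleftrightarrow> (\<forall>j\<in>{1..2 * r}. v j \<in> {1..n}) \<and> (\<forall>j\<in>J. v j \<in> B j)"
      using J B by (metis subsetD)
    then show ?thesis unfolding offers_def PiE_iff by blast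
  qed
  then have "{v \<in> offers r n. \<forall>j\<in>J. v j \<in> B j} = PiE {1..2 * r} ?B" by blast
  then have "real (card {v \<in> offers r n. \<forall>j\<in>J. v j \<in> B j}) / real n ^ (2 * r) =
      (\<Prod>j\<in>{1..2 * r}. real (card (?B j))) / (\<Prod>j\<in>{1..2 * r}. real n)"
    by (simp add: card_PiE)
  also have "\<dots> = (\<Prod>j\<in>{1..2 * r}. real (card (?B j)) / n)"
    by (rule prod_dividef[symmetric])
  also have "\<dots> = (\<Prod>j\<in>J. real (card (?B j)) / n)"
    using J n by (intro prod.mono_neutral_right) auto
  finally show ?thesis by simp
qed

lemma offers_average_first_pair:
  fixes f :: "nat \<Rightarrow> nat \<Rightarrow> real"
  assumes r: "r > 0" and n: "n > 0"
  shows "(\<Sum>v\<in>offers r n. f (v 1) (v 2)) / real n ^ (2 * r) = (\<Sum>a\<in>{1..n}. \<Sum>b\<in>{1..n}. f a b) / (real n)\<^sup>2"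
proof -
  have sub: "{1, 2} \<subseteq> {1..2 * r}" using r by auto
  have "(\<Sum>v\<in>offers r n. f (v 1) (v 2)) =
    (\<Sum>p\<in>{1..n} \<times> {1..n}. \<Sum>v\<in>{v \<in> offers r n. (v 1, v 2) = p}. f (v 1) (v 2))"
  proof (rule sum.group[symmetric])
    show "(\<lambda>v. (v 1, v 2)) ` offers r n \<subseteq> {1..n} \<times> {1..n}"
      using sub offers_mem[of _ r n] by blast
  qed (auto simp: finite_offers)
  also have "\<dots> = (\<Sum>p\<in>{1..n} \<times> {1..n}. f (fst p) (snd p) * card {v \<in> offers r n. (v 1, v 2) = p})"
  proof (rule sum.cong[OF refl])
    fix p
    have "(\<Sum>v\<in>{v \<in> offers r n. (v 1, v 2) = p}. f (v 1) (v 2)) =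
      (\<Sum>v\<in>{v \<in> offers r n. (v 1, v 2) = p}. f (fst p) (snd p))"
      by (rule sum.cong) auto
    then show "(\<Sum>v\<in>{v \<in> offers r n. (v 1, v 2) = p}. f (v 1) (v 2)) =
       f (fst p) (snd p) * card {v \<in> offers r n. (v 1, v 2) = p}" by simp
  qed
  also have "\<dots> / real n ^ (2 * r) = (\<Sum>p\<in>{1..n} \<times> {1..n}. f (fst p) (snd p) / (real n)\<^sup>2)"
    unfolding sum_divide_distrib
  proof (rule sum.cong[OF refl])
    fix p assume p: "p \<in> {1..n} \<times> {1..n}"
    have "real (card {v \<in> offers r n. \<forall>j\<in>{1, 2}. v j \<in> (if j = 1 then {fst p} else {snd p})}) / real n ^ (2 * r)
      = (\<Prod>j\<in>{1::nat, 2}. real (card (if j = 1 then {fst p} else {snd p})) / n)"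
      using p by (intro offers_fraction[OF n sub]) auto
    also have "{v \<in> offers r n. \<forall>j\<in>{1, 2}. v j \<in> (if j = 1 then {fst p} else {snd p})} =
        {v \<in> offers r n. (v 1, v 2) = p}"
      by (auto simp: prod_eq_iff)
    finally have "real (card {v \<in> offers r n. (v 1, v 2) = p}) / real n ^ (2 * r) = 1 / (real n)\<^sup>2"
      by (simp add: power2_eq_square)
    then show "f (fst p) (snd p) * card {v \<in> offers r n. (v 1, v 2) = p} / real n ^ (2 * r) =
        f (fst p) (snd p) / (real n)\<^sup>2"
      unfolding times_divide_eq_right[symmetric] by (simp only: mult_1_right times_divide_eq_right)
  qed
  also have "\<dots> = (\<Sum>a\<in>{1..n}. \<Sum>b\<in>{1..n}. f a b) / (real n)\<^sup>2"
    by (simp add: sum.cartesian_product sum_divide_distrib split_beta)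
  finally show ?thesis .
qed

section \<open>The critical graph\<close>

text \<open>
  These bounds make the contribution of a component to the transform and to its derivatives uniformly
  bounded, however large the component is, as long as \<open>s\<close> stays away from 0.
\<close>

lemma mult_exp_minus_le:
  fixes s c :: real
  assumes "s > 0" "c \<ge> 0"
  shows "c * exp (- s * c) \<le> 1 / s" "c\<^sup>2 * exp (- s * c) \<le> 2 / s\<^sup>2"
proof -
  have "s * c \<le> exp (s * c)" using exp_ge_add_one_self[of "s * c"] by linarith
  then show "c * exp (- s * c) \<le> 1 / s" using assms by (simp add: exp_minus field_simps)
  have "(s * c)\<^sup>2 / 2 \<le> exp (s * c)"
    using exp_lower_Taylor_quadratic[of "s * c"] assms
    by (smt (verit) mult_nonneg_nonneg)
  then show "c\<^sup>2 * exp (- s * c) \<le> 2 / s\<^sup>2"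
    using assms by (simp add: exp_minus field_simps power_mult_distrib)
qed

lemma exp_minus_le:
  fixes x :: real
  assumes "0 \<le> x"
  shows "exp (- x) \<le> 1 - x + x\<^sup>2 / 2"
proof -
  have "exp (- x) * (1 + x + x\<^sup>2 / 2) \<le> exp (- x) * exp x"
    using exp_lower_Taylor_quadratic[OF assms] by (intro mult_left_mono) auto
  also have "\<dots> = 1" by (simp flip: exp_add)
  also have "1 \<le> (1 - x + x\<^sup>2 / 2) * (1 + x + x\<^sup>2 / 2)"
  proof -
    have "(1 - x + x\<^sup>2 / 2) * (1 + x + x\<^sup>2 / 2) = 1 + (x\<^sup>2 / 2)\<^sup>2"
      by (simp add: power2_eq_square algebra_simps)
    then show ?thesis by simp
  qed
  finally show ?thesis
    using assms by (rule_tac mult_right_le_imp_le) (auto intro: add_pos_nonneg)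
qed

text \<open>
  One step along the characteristic.  With \<open>M\<close> the average of \<open>|C(v)| exp (-s |C(v)|)\<close>, a random edge
  changes the transform \<open>F\<close> by about \<open>2 M (F - 1) / n\<close> on average, and the shift of the argument from
  \<open>s + 2 u / n\<close> to \<open>s\<close> changes it by about \<open>2 u M / n\<close>.  The speed \<open>2 u / n\<close> is chosen so that the sum is
  \<open>2 M / n\<close> times the deviation \<open>D = F - (1 - u)\<close>: the deviation has no constant drift, and since
  \<open>M \<le> 1 / s \<le> A\<close> it is amplified only by a factor \<open>1 + O(A / n)\<close>.  The fluctuation of one step is
  \<open>O(A / n)\<close>, because by the preceding bounds each component contributes at most \<open>A / n\<close>.
\<close>

lemma random_edge_second_moment:
  fixes s A u :: real and n :: nat and E :: edges and F :: "edges \<Rightarrow> real \<Rightarrow> real"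
  defines "F \<equiv> \<lambda>E s. size_sum n E (\<lambda>c. exp (- s * real c)) / n"
  assumes n: "n > 0" and E: "edges_on n E" and A: "A > 0" "1 / A \<le> s"
    and u: "0 \<le> u" "u \<le> 1"
  shows "(\<Sum>a\<in>{1..n}. \<Sum>b\<in>{1..n}. (F (insert {a, b} E) s - (1 - u))\<^sup>2) / (real n)\<^sup>2
    \<le> (1 + 4 * A / n) * (F E (s + 2 * u / n) - (1 - u))\<^sup>2 + 40 * A\<^sup>2 / (real n)\<^sup>2"
proof -
  define h where "h = 2 * u / n"
  define g where "g = (\<lambda>c::nat. exp (- s * c))"
  define M where "M = size_sum n E (\<lambda>c. c * g c) / n"
  define D where "D = F E (s + h) - (1 - u)"
  define \<delta> where "\<delta> = F E s - F E (s + h)"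
  define c where "c = csize E"
  \<comment> \<open>The change of the unnormalized transform if \<open>a\<close> and \<open>b\<close> lie in different components.\<close>
  define T where "T = (\<lambda>a b. real (c a + c b) * g (c a + c b) - real (c a) * g (c a) - real (c b) * g (c b))"
  define \<Delta> where "\<Delta> = (\<lambda>a b. if b \<in> component E a then 0 else T a b)"
  let ?V = "{1..n}"
  have "0 < 1 / A" using A by simp
  then have s: "s > 0" using A(2) by linarith
  then have s': "1 / s \<le> A" using A by (simp add: field_simps)
  have h: "0 \<le> h" "h \<le> 2 / n" using u n by (auto simp: h_def field_simps)
  have g1: "0 \<le> real k * g k" "real k * g k \<le> A" for k
    using mult_exp_minus_le(1)[of s "real k"] s s' by (auto simp: g_def)
  have g2: "(real k)\<^sup>2 * g k \<le> 2 * A\<^sup>2" for k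
  proof -
    have "2 / s\<^sup>2 = 2 * (1 / s)\<^sup>2" by (simp add: power_divide)
    also have "\<dots> \<le> 2 * A\<^sup>2" using s s' by (intro mult_left_mono power_mono) auto
    finally show ?thesis using mult_exp_minus_le(2)[of s "real k"] s s' by (simp add: g_def)
  qed
  have M: "0 \<le> M" "M \<le> A"
  proof -
    show "0 \<le> M" unfolding M_def size_sum_def using g1 by (intro divide_nonneg_nonneg sum_nonneg) auto
    have "size_sum n E (\<lambda>c. c * g c) \<le> (\<Sum>v\<in>?V. A)"
      unfolding size_sum_def using g1 by (intro sum_mono) auto
    then show "M \<le> A" using n by (simp add: M_def field_simps)
  qed
  have T_bound: "\<bar>T a b\<bar> \<le> 2 * A" for a b
    using g1[of "c a"] g1[of "c b"] g1[of "c a + c b"] A unfolding T_def by linarith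
  have \<Delta>_bound: "\<bar>\<Delta> a b\<bar> \<le> 2 * A" for a b
    using T_bound[of a b] A by (simp add: \<Delta>_def)
  have F_range: "0 \<le> F E t" "F E t \<le> 1" if "t \<ge> 0" for t
  proof -
    show "0 \<le> F E t" unfolding F_def size_sum_def by (intro divide_nonneg_nonneg sum_nonneg) auto
    have "size_sum n E (\<lambda>c. exp (- t * c)) \<le> (\<Sum>v\<in>?V. 1)"
      unfolding size_sum_def using that by (intro sum_mono) auto
    then show "F E t \<le> 1" using n by (simp add: F_def field_simps)
  qed
  have D_range: "\<bar>D\<bar> \<le> 1" using F_range[of "s + h"] s h u unfolding D_def by auto
  have \<delta>_sum: "\<delta> = (\<Sum>v\<in>?V. g (c v) * (1 - exp (- h * c v))) / n"
  proof -
    have "g k * (1 - exp (- h * k)) = exp (- s * k) - exp (- (s + h) * k)" for k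
      by (simp add: g_def algebra_simps flip: exp_add)
    then have "(\<Sum>v\<in>?V. g (c v) * (1 - exp (- h * c v))) =
        (\<Sum>v\<in>?V. exp (- s * c v) - exp (- (s + h) * c v))"
      by (intro sum.cong refl) blast
    then show ?thesis
      unfolding \<delta>_def F_def size_sum_def c_def sum_subtractf diff_divide_distrib[symmetric] by simp
  qed
  have \<delta>_upper: "\<delta> \<le> h * M"
  proof -
    have "g k * (1 - exp (- h * k)) \<le> h * (k * g k)" for k
    proof -
      have "1 - exp (- h * k) \<le> h * k" using exp_ge_add_one_self[of "- h * k"] by simp
      then have "g k * (1 - exp (- h * k)) \<le> g k * (h * k)" by (intro mult_left_mono) (auto simp: g_def)
      then show ?thesis by (simp add: mult_ac)
    qed
    then have "(\<Sum>v\<in>?V. g (c v) * (1 - exp (- h * c v))) \<le> (\<Sum>v\<in>?V. h * (c v * g (c v)))"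
      by (intro sum_mono) auto
    then show ?thesis
      using n by (simp add: \<delta>_sum M_def size_sum_def c_def sum_distrib_left divide_right_mono)
  qed
  have \<delta>_lower: "h * M - h\<^sup>2 * A\<^sup>2 \<le> \<delta>"
  proof -
    have "h * (k * g k) - h\<^sup>2 * A\<^sup>2 \<le> g k * (1 - exp (- h * k))" for k :: nat
    proof -
      let ?x = "h * real k"
      have x: "0 \<le> ?x" using h by simp
      have "exp (- ?x) \<le> 1 - ?x + ?x\<^sup>2 / 2" using x by (rule exp_minus_le)
      then have "g k * (?x - ?x\<^sup>2 / 2) \<le> g k * (1 - exp (- ?x))"
        by (intro mult_left_mono) (auto simp: g_def)
      moreover have "h\<^sup>2 / 2 * ((real k)\<^sup>2 * g k) \<le> h\<^sup>2 / 2 * (2 * A\<^sup>2)"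
        using g2[of k] by (intro mult_left_mono) auto
      ultimately show ?thesis by (simp add: algebra_simps power_mult_distrib)
    qed
    then have "(\<Sum>v\<in>?V. h * (c v * g (c v)) - h\<^sup>2 * A\<^sup>2) \<le> (\<Sum>v\<in>?V. g (c v) * (1 - exp (- h * c v)))"
      by (intro sum_mono) auto
    then have "(\<Sum>v\<in>?V. h * (c v * g (c v)) - h\<^sup>2 * A\<^sup>2) / n \<le> \<delta>"
      unfolding \<delta>_sum by (rule divide_right_mono) simp
    moreover have "(\<Sum>v\<in>?V. h * (c v * g (c v)) - h\<^sup>2 * A\<^sup>2) / n = h * M - h\<^sup>2 * A\<^sup>2"
      using n by (simp add: M_def size_sum_def c_def sum_subtractf sum_distrib_left diff_divide_distrib)
    ultimately show ?thesis by simp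
  qed
  have \<delta>_nonneg: "0 \<le> \<delta>"
    unfolding \<delta>_sum using h by (intro divide_nonneg_nonneg sum_nonneg mult_nonneg_nonneg) (auto simp: g_def)
  have hM: "h * M \<le> 2 * A / n"
    using mult_mono[OF h(2) M(2)] h M n by simp
  have h2: "h\<^sup>2 \<le> 4 / (real n)\<^sup>2" using power_mono[OF h(2) h(1), of 2] by (simp add: power_divide)

  have F_new: "F (insert {a, b} E) s - (1 - u) = D + (\<delta> + \<Delta> a b / n)" if "a \<in> ?V" "b \<in> ?V" for a b
    using size_sum_insert[OF E that, of g] n
    by (auto simp: F_def D_def \<delta>_def \<Delta>_def T_def c_def g_def field_simps)

  define S where "S = (\<Sum>a\<in>?V. \<Sum>b\<in>?V. \<Delta> a b)"
  \<comment> \<open>Summing \<open>T\<close> over all pairs factorizes as \<open>g\<close> is exponential.  The pairs inside one component,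
    counted in that sum but without effect, contribute only \<open>O(A^2)\<close> per vertex.\<close>
  have S: "\<bar>S - (real n)\<^sup>2 * (2 * M * (F E s - 1))\<bar> \<le> n * (4 * A\<^sup>2)"
  proof -
    have TS: "(\<Sum>a\<in>?V. \<Sum>b\<in>?V. T a b) = (real n)\<^sup>2 * (2 * M * (F E s - 1))"
    proof -
      let ?G = "\<Sum>v\<in>?V. g (c v)" and ?K = "\<Sum>v\<in>?V. c v * g (c v)"
      have "T a b = (c a * g (c a)) * g (c b) + g (c a) * (c b * g (c b)) - c a * g (c a) - c b * g (c b)" for a b
      proof -
        have "g (c a + c b) = g (c a) * g (c b)" by (simp add: g_def algebra_simps flip: exp_add)
        then show ?thesis by (simp add: T_def algebra_simps)
      qed
      then have "(\<Sum>a\<in>?V. \<Sum>b\<in>?V. T a b) = ?K * ?G + ?G * ?K - n * ?K - n * ?K"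
        by (simp add: sum.distrib sum_subtractf sum_product flip: sum_distrib_left)
      moreover have "?G = n * F E s" "?K = n * M"
        using n by (simp_all add: F_def M_def size_sum_def c_def g_def)
      ultimately show ?thesis by (simp add: algebra_simps power2_eq_square)
    qed
    have "(\<Sum>b\<in>?V. \<Delta> a b) = (\<Sum>b\<in>?V. T a b) - c a * T a a" if a: "a \<in> ?V" for a
    proof -
      have sub: "component E a \<subseteq> ?V" using component_subset[OF E a] .
      have "(\<Sum>b\<in>?V. \<Delta> a b) = (\<Sum>b\<in>?V - component E a. T a b)"
        unfolding \<Delta>_def by (rule sum.mono_neutral_cong_right) auto
      also have "\<dots> = (\<Sum>b\<in>?V. T a b) - (\<Sum>b\<in>component E a. T a b)"
        using sub by (intro sum_diff) auto
      also have "(\<Sum>b\<in>component E a. T a b) = (\<Sum>b\<in>component E a. T a a)"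
        by (rule sum.cong[OF refl]) (simp add: T_def c_def component_eq[of _ E a])
      finally show ?thesis by (simp add: c_def)
    qed
    then have "S = (real n)\<^sup>2 * (2 * M * (F E s - 1)) - (\<Sum>a\<in>?V. c a * T a a)"
      unfolding S_def TS[symmetric] sum_subtractf[symmetric] by (intro sum.cong refl) blast
    moreover have "\<bar>\<Sum>a\<in>?V. c a * T a a\<bar> \<le> (\<Sum>a\<in>?V. 4 * A\<^sup>2)"
    proof (rule order_trans[OF sum_abs], rule sum_mono)
      fix a
      have "c a * T a a = 2 * (real (c a))\<^sup>2 * g (2 * c a) - 2 * ((real (c a))\<^sup>2 * g (c a))"
        by (simp add: T_def power2_eq_square algebra_simps flip: mult_2)
      moreover have "2 * (real (c a))\<^sup>2 * g (2 * c a) \<le> 4 * A\<^sup>2"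
      proof -
        have "4 * ((real (c a))\<^sup>2 * g (2 * c a)) \<le> 2 * A\<^sup>2"
          using g2[of "2 * c a"] by (simp add: power_mult_distrib)
        then show ?thesis using zero_le_power2[of A] by linarith
      qed
      moreover have "0 \<le> 2 * (real (c a))\<^sup>2 * g (2 * c a)" "0 \<le> 2 * ((real (c a))\<^sup>2 * g (c a))"
        by (auto simp: g_def)
      ultimately show "\<bar>c a * T a a\<bar> \<le> 4 * A\<^sup>2" using g2[of "c a"] by linarith
    qed
    ultimately show ?thesis by simp
  qed
  have X_expand: "(\<Sum>a\<in>?V. \<Sum>b\<in>?V. (\<delta> + \<Delta> a b / n)) = (real n)\<^sup>2 * (\<delta> + S / (real n) ^ 3)"
    using n by (simp add: S_def sum.distrib power2_eq_square power3_eq_cube field_simps flip: sum_divide_distrib)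
  \<comment> \<open>Three errors of size \<open>4 * A^2 / n^2\<close> each: the pairs inside one component, the second order
    term of the shift of \<open>s\<close>, and the shift inside the drift of the random edge.\<close>
  have drift: "\<bar>\<delta> + S / (real n) ^ 3 - 2 * M / n * D\<bar> \<le> 12 * A\<^sup>2 / (real n)\<^sup>2"
  proof -
    have "F E s - 1 = D - u + \<delta>" by (simp add: D_def \<delta>_def)
    then have eq: "2 * M * (F E s - 1) / n = 2 * M / n * D - h * M + 2 * M * \<delta> / n"
      by (simp only:) (simp add: h_def algebra_simps add_divide_distrib diff_divide_distrib)
    have "\<bar>S / (real n) ^ 3 - 2 * M * (F E s - 1) / n\<bar> = \<bar>S - (real n)\<^sup>2 * (2 * M * (F E s - 1))\<bar> / (real n) ^ 3"
    proof -
      have "S / (real n) ^ 3 - Q / n = (S - (real n)\<^sup>2 * Q) / (real n) ^ 3" for Q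
        using n by (simp add: field_simps power2_eq_square power3_eq_cube)
      then show ?thesis by (simp add: abs_divide)
    qed
    also have "\<dots> \<le> n * (4 * A\<^sup>2) / (real n) ^ 3" using S by (intro divide_right_mono) auto
    also have "\<dots> = 4 * A\<^sup>2 / (real n)\<^sup>2" using n by (simp add: power2_eq_square power3_eq_cube)
    finally have 1: "\<bar>S / (real n) ^ 3 - 2 * M * (F E s - 1) / n\<bar> \<le> 4 * A\<^sup>2 / (real n)\<^sup>2" .
    have 2: "\<bar>\<delta> - h * M\<bar> \<le> 4 * A\<^sup>2 / (real n)\<^sup>2"
    proof -
      have "h\<^sup>2 * A\<^sup>2 \<le> 4 / (real n)\<^sup>2 * A\<^sup>2" using h2 by (intro mult_right_mono) auto
      then show ?thesis using \<delta>_lower \<delta>_upper by simp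
    qed
    have "2 * M * \<delta> / n \<le> 2 * A * (2 * A / n) / n"
      using M \<delta>_nonneg \<delta>_upper hM A n by (intro divide_right_mono mult_mono) auto
    then have 3: "2 * M * \<delta> / n \<le> 4 * A\<^sup>2 / (real n)\<^sup>2" by (simp add: power2_eq_square)
    have 4: "0 \<le> 2 * M * \<delta> / n" using M \<delta>_nonneg by simp
    have "\<bar>x + p - q\<bar> \<le> 3 * k"
      if "\<bar>p - w\<bar> \<le> k" "\<bar>x - y\<bar> \<le> k" "z \<le> k" "0 \<le> z" "w = q - y + z" for x y z p q w k :: real
      using that by linarith
    from this[OF 1 2 3 4 eq] show ?thesis by simp
  qed
  have sq: "(\<delta> + \<Delta> a b / n)\<^sup>2 \<le> 16 * A\<^sup>2 / (real n)\<^sup>2" for a b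
  proof -
    have "\<bar>\<Delta> a b / n\<bar> \<le> 2 * A / n" using \<Delta>_bound[of a b] by (simp add: divide_right_mono)
    moreover have "4 * A / n = 2 * (2 * A / n)" by simp
    ultimately have "\<bar>\<delta> + \<Delta> a b / n\<bar> \<le> 4 * A / n" using \<delta>_nonneg \<delta>_upper hM by linarith
    then have "\<bar>\<delta> + \<Delta> a b / n\<bar>\<^sup>2 \<le> (4 * A / n)\<^sup>2" by (intro power_mono) auto
    then show ?thesis by (simp add: power_divide power_mult_distrib)
  qed
  have "(\<Sum>a\<in>?V. \<Sum>b\<in>?V. (F (insert {a, b} E) s - (1 - u))\<^sup>2) =
      (\<Sum>a\<in>?V. \<Sum>b\<in>?V. D\<^sup>2 + 2 * D * (\<delta> + \<Delta> a b / n) + (\<delta> + \<Delta> a b / n)\<^sup>2)"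
    by (intro sum.cong refl) (simp add: F_new power2_sum)
  also have "\<dots> \<le> (\<Sum>a\<in>?V. \<Sum>b\<in>?V. D\<^sup>2 + 2 * D * (\<delta> + \<Delta> a b / n) + 16 * A\<^sup>2 / (real n)\<^sup>2)"
    by (intro sum_mono add_mono order_refl sq)
  also have "\<dots> = (real n)\<^sup>2 * D\<^sup>2 + 2 * D * (\<Sum>a\<in>?V. \<Sum>b\<in>?V. (\<delta> + \<Delta> a b / n)) + (real n)\<^sup>2 * (16 * A\<^sup>2 / (real n)\<^sup>2)"
    unfolding sum_distrib_left by (subst sum.distrib, subst sum.distrib)
      (simp add: sum.distrib power2_eq_square del: distrib_left_numeral)
  also have "\<dots> = (real n)\<^sup>2 * (D\<^sup>2 + 2 * D * (\<delta> + S / (real n) ^ 3) + 16 * A\<^sup>2 / (real n)\<^sup>2)"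
    unfolding X_expand by (simp add: algebra_simps)
  finally have main: "(\<Sum>a\<in>?V. \<Sum>b\<in>?V. (F (insert {a, b} E) s - (1 - u))\<^sup>2) / (real n)\<^sup>2
      \<le> D\<^sup>2 + 2 * D * (\<delta> + S / (real n) ^ 3) + 16 * A\<^sup>2 / (real n)\<^sup>2"
    using n by (simp add: pos_divide_le_eq mult.commute)
  have "D * (\<delta> + S / (real n) ^ 3) = 2 * M / n * D\<^sup>2 + D * (\<delta> + S / (real n) ^ 3 - 2 * M / n * D)"
    by (simp add: algebra_simps power2_eq_square)
  moreover have "2 * M / n * D\<^sup>2 \<le> 2 * A / n * D\<^sup>2"
    using M n by (intro mult_right_mono divide_right_mono) auto
  moreover have "D * (\<delta> + S / (real n) ^ 3 - 2 * M / n * D) \<le> 1 * (12 * A\<^sup>2 / (real n)\<^sup>2)"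
  proof -
    have "\<bar>D * (\<delta> + S / (real n) ^ 3 - 2 * M / n * D)\<bar> \<le> 1 * (12 * A\<^sup>2 / (real n)\<^sup>2)"
      unfolding abs_mult using drift D_range by (intro mult_mono) auto
    then show ?thesis by linarith
  qed
  moreover have "(1 + 4 * A / n) * D\<^sup>2 = D\<^sup>2 + 2 * (2 * A / n * D\<^sup>2)" by (simp add: algebra_simps)
  moreover have "40 * A\<^sup>2 / (real n)\<^sup>2 = 2 * (12 * A\<^sup>2 / (real n)\<^sup>2) + 16 * A\<^sup>2 / (real n)\<^sup>2" by simp
  ultimately have "D\<^sup>2 + 2 * D * (\<delta> + S / (real n) ^ 3) + 16 * A\<^sup>2 / (real n)\<^sup>2
      \<le> (1 + 4 * A / n) * D\<^sup>2 + 40 * A\<^sup>2 / (real n)\<^sup>2"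
    by linarith
  then show ?thesis using main unfolding D_def h_def by linarith
qed

abbreviation critical_pmf :: "nat \<Rightarrow> nat \<Rightarrow> edges pmf" where
  "critical_pmf r n \<equiv> graph_pmf r n 0 {} (n div 2)"

lemma pmf_prob_mono:
  assumes "\<And>x. x \<in> set_pmf p \<Longrightarrow> P x \<Longrightarrow> Q x"
  shows "measure_pmf.prob p {x. P x} \<le> measure_pmf.prob p {x. Q x}"
  using assms by (intro measure_pmf.finite_measure_mono_AE) (auto simp: AE_measure_pmf_iff)

text \<open>
  At time 0 every component is a single vertex, so the deviation on the characteristic that starts at
  \<open>\<sigma>\<close> is exactly 0.  During the \<open>n div 2\<close> uniform steps the argument \<open>s\<close> decreases from \<open>\<sigma>\<close> to
  \<open>\<sigma> - u\<close>, up to \<open>u / n\<close> for odd \<open>n\<close>, and so never falls below \<open>\<sigma> - u > 0\<close>.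
\<close>

lemma critical_transform_concentration:
  fixes \<sigma> \<epsilon> :: real
  defines "u \<equiv> 1 - exp (- \<sigma>)"
  assumes r: "r > 0" and n: "n > 0" and pos: "\<epsilon> > 0" and \<sigma>: "\<sigma> > 0" "\<sigma> > u"
  shows "measure_pmf.prob (critical_pmf r n)
      {E. \<epsilon> \<le> \<bar>size_sum n E (\<lambda>c. exp (- (\<sigma> - 2 * u * (n div 2) / n) * real c)) / n - (1 - u)\<bar>}
    \<le> (exp (4 / (\<sigma> - u)) * 40 / ((\<sigma> - u)\<^sup>2 * \<epsilon>\<^sup>2)) / n"
proof -
  define A where "A = 1 / (\<sigma> - u)"
  have A: "A > 0" using \<sigma> by (simp add: A_def)
  have u: "0 \<le> u" "u \<le> 1" using \<sigma>(1) by (auto simp: u_def)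
  define t where "t = (\<lambda>j::nat. \<sigma> - 2 * u * j / n)"
  define h where "h = (\<lambda>j F. (size_sum n F (\<lambda>c. exp (- t j * real c)) / n - (1 - u))\<^sup>2)"
  let ?m = "n div 2"
  let ?p = "critical_pmf r n"
  have t: "1 / A \<le> t j" if "j \<le> ?m" for j
  proof -
    have "real (2 * j) \<le> real n" using that by (intro of_nat_mono) auto
    then have "2 * u * j \<le> u * n" using u by (simp add: mult_left_mono mult.assoc mult.left_commute)
    then have "2 * u * j / n \<le> u" using n by (simp add: field_simps)
    then show ?thesis by (simp add: A_def t_def)
  qed
  have "measure_pmf.expectation ?p (h ?m) \<le> (1 + 4 * A / n) ^ ?m * (h 0 {} + ?m * (40 * A\<^sup>2 / (real n)\<^sup>2))"
  proof (rule expectation_graph_pmf_le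
      [where h = h and m = ?m and c = "1 + 4 * A / n" and d = "40 * A\<^sup>2 / (real n)\<^sup>2", OF r n edges_on_empty])
    fix j F assume j: "j < ?m" and F: "edges_on n F"
    have "next_graph r n (0 + j) F v = insert {v 1, v 2} F" for v
      using j by (simp add: next_graph_def)
    then have "(\<Sum>v\<in>offers r n. h (Suc j) (next_graph r n (0 + j) F v)) / real n ^ (2 * r) =
        (\<Sum>v\<in>offers r n. h (Suc j) (insert {v 1, v 2} F)) / real n ^ (2 * r)" by simp
    also have "\<dots> = (\<Sum>a\<in>{1..n}. \<Sum>b\<in>{1..n}. h (Suc j) (insert {a, b} F)) / (real n)\<^sup>2"
      by (rule offers_average_first_pair[OF r n])
    also have "\<dots> \<le> (1 + 4 * A / n) * (size_sum n F (\<lambda>c. exp (- (t (Suc j) + 2 * u / n) * real c)) / n - (1 - u))\<^sup>2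
        + 40 * A\<^sup>2 / (real n)\<^sup>2"
      unfolding h_def using j by (intro random_edge_second_moment n F A t u) auto
    also have "t (Suc j) + 2 * u / n = t j" by (simp add: t_def field_simps add_divide_distrib)
    finally show "(\<Sum>v\<in>offers r n. h (Suc j) (next_graph r n (0 + j) F v)) / real n ^ (2 * r)
        \<le> (1 + 4 * A / n) * h j F + 40 * A\<^sup>2 / (real n)\<^sup>2"
      by (simp add: h_def)
  qed (use A in auto)
  also have "h 0 {} = 0"
  proof -
    have "component {} v = {v}" for v by (auto simp: component_def)
    then have "size_sum n {} g = n * g 1" for g :: "nat \<Rightarrow> real" by (simp add: size_sum_def)
    then show ?thesis using n by (simp add: h_def t_def u_def)
  qed
  also have "(1 + 4 * A / n) ^ ?m * (0 + ?m * (40 * A\<^sup>2 / (real n)\<^sup>2)) \<le> exp (4 * A) * (n * (40 * A\<^sup>2 / (real n)\<^sup>2))"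
  proof (rule mult_mono)
    have "(1 + 4 * A / n) ^ ?m \<le> exp (4 * A / n) ^ ?m"
      using A n exp_ge_add_one_self[of "4 * A / n"] by (intro power_mono) auto
    also have "\<dots> = exp (?m * (4 * A / n))" by (rule exp_of_nat_mult[symmetric])
    also have "\<dots> \<le> exp (4 * A)"
    proof -
      have "real ?m * (4 * A / n) \<le> n * (4 * A / n)"
        using A by (intro mult_right_mono) auto
      then show ?thesis using n by simp
    qed
    finally show "(1 + 4 * A / n) ^ ?m \<le> exp (4 * A)" .
  next
    have "real ?m * (40 * A\<^sup>2 / (real n)\<^sup>2) \<le> n * (40 * A\<^sup>2 / (real n)\<^sup>2)"
      by (intro mult_right_mono) auto
    then show "0 + real ?m * (40 * A\<^sup>2 / (real n)\<^sup>2) \<le> n * (40 * A\<^sup>2 / (real n)\<^sup>2)" by simp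
  qed auto
  also have "\<dots> = exp (4 * A) * 40 * A\<^sup>2 / n" using n by (simp add: power2_eq_square)
  finally have exp_h: "measure_pmf.expectation ?p (h ?m) \<le> exp (4 * A) * 40 * A\<^sup>2 / n" .
  have "measure_pmf.prob ?p {E. \<epsilon> \<le> \<bar>size_sum n E (\<lambda>c. exp (- t ?m * real c)) / n - (1 - u)\<bar>}
      \<le> measure_pmf.prob ?p {E. \<epsilon>\<^sup>2 \<le> h ?m E}"
  proof (rule pmf_prob_mono)
    fix E assume "\<epsilon> \<le> \<bar>size_sum n E (\<lambda>c. exp (- t ?m * real c)) / n - (1 - u)\<bar>"
    then have "\<epsilon>\<^sup>2 \<le> \<bar>size_sum n E (\<lambda>c. exp (- t ?m * real c)) / n - (1 - u)\<bar>\<^sup>2"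
      using pos by (intro power_mono) auto
    then show "\<epsilon>\<^sup>2 \<le> h ?m E" by (simp add: h_def)
  qed
  also have "\<dots> \<le> measure_pmf.expectation ?p (h ?m) / \<epsilon>\<^sup>2"
    using pos by (intro pmf_markov finite_set_graph_pmf n) (auto simp: h_def)
  also have "\<dots> \<le> exp (4 * A) * 40 * A\<^sup>2 / n / \<epsilon>\<^sup>2"
    using exp_h by (intro divide_right_mono) auto
  also have "\<dots> = (exp (4 / (\<sigma> - u)) * 40 / ((\<sigma> - u)\<^sup>2 * \<epsilon>\<^sup>2)) / n"
    by (simp add: A_def power_divide)
  finally show ?thesis by (simp add: t_def)
qed

text \<open>
  The scaling at criticality: \<open>u\<close> is of order \<open>\<sigma>\<close>, and the end point \<open>\<sigma> - u\<close> of the characteristic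
  is of order \<open>\<sigma>^2\<close>.
\<close>

lemma characteristic_bounds:
  fixes \<sigma> :: real
  defines "u \<equiv> 1 - exp (- \<sigma>)"
  assumes "0 < \<sigma>" "\<sigma> \<le> 1"
  shows "u \<le> \<sigma>" "\<sigma> / 2 \<le> u" "\<sigma>\<^sup>2 / 4 \<le> \<sigma> - u" "\<sigma> - u \<le> \<sigma>\<^sup>2 / 2"
proof -
  have half: "x / 2 \<le> 1 - exp (- x)" if "0 \<le> x" "x \<le> 1" for x :: real
  proof -
    have "x\<^sup>2 \<le> x" using that by (simp add: power2_eq_square mult_left_le)
    then show ?thesis using exp_minus_le[OF that(1)] by linarith
  qed
  show "u \<le> \<sigma>" using exp_ge_add_one_self[of "- \<sigma>"] by (simp add: u_def)
  show "\<sigma> / 2 \<le> u" using half assms by (simp add: u_def)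
  show "\<sigma> - u \<le> \<sigma>\<^sup>2 / 2" using exp_minus_le[of \<sigma>] assms by (simp add: u_def)
  let ?f = "\<lambda>x::real. x - 1 + exp (- x) - x\<^sup>2 / 4"
  have "?f 0 \<le> ?f \<sigma>"
  proof (rule DERIV_nonneg_imp_nondecreasing[where f = ?f and a = 0 and b = \<sigma>])
    fix x assume x: "0 \<le> x" "x \<le> \<sigma>"
    have "(?f has_real_derivative 1 - exp (- x) - x / 2) (at x)"
      by (auto intro!: derivative_eq_intros)
    then show "\<exists>y. (?f has_real_derivative y) (at x) \<and> 0 \<le> y"
      using half[of x] x assms by (intro exI[of _ "1 - exp (- x) - x / 2"]) auto
  qed (use assms in auto)
  then show "\<sigma>\<^sup>2 / 4 \<le> \<sigma> - u" by (simp add: u_def)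
qed

lemma tendsto_0_if_le_const_over_n:
  fixes f :: "nat \<Rightarrow> real"
  assumes "\<And>n. 0 \<le> f n" "\<forall>\<^sub>F n in sequentially. f n \<le> K / n"
  shows "f \<longlonglongrightarrow> 0"
  by (rule tendsto_sandwich[of "\<lambda>_. 0"]) (use assms lim_const_over_n in auto)

text \<open>
  Taking \<open>\<sigma> = k powr (-1/2)\<close> for \<open>k = 4 ^ j\<close> makes the final argument \<open>s\<close> at least \<open>1 / (4 k)\<close>.
  Then every vertex in a component of size at least \<open>k\<close> contributes at least
  \<open>1 - exp (-1/4) \<ge> 1/8\<close> to the sum of \<open>1 - exp (-s |C(v)|)\<close>, which is at most \<open>2 \<sigma> n\<close> with high
  probability.
\<close>

lemma critical_tail:
  assumes r: "r > 0"
  shows "(\<lambda>n. measure_pmf.prob (critical_pmf r n) {E. 16 / 2 ^ j * real n < vertices_ge n E (4 ^ j)}) \<longlonglongrightarrow> 0"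
proof -
  define \<sigma> :: real where "\<sigma> = 1 / 2 ^ j"
  define u where "u = 1 - exp (- \<sigma>)"
  have \<sigma>: "0 < \<sigma>" "\<sigma> \<le> 1" by (auto simp: \<sigma>_def)
  note bounds = characteristic_bounds[OF \<sigma>, folded u_def]
  have "u < \<sigma>" using bounds(3) zero_less_power[OF \<sigma>(1), of 2] by linarith
  let ?K = "exp (4 / (\<sigma> - u)) * 40 / ((\<sigma> - u)\<^sup>2 * \<sigma>\<^sup>2)"
  have "measure_pmf.prob (critical_pmf r n) {E. 16 / 2 ^ j * real n < vertices_ge n E (4 ^ j)} \<le> ?K / n"
    if n: "n > 0" for n
  proof -
    define s where "s = \<sigma> - 2 * u * (n div 2) / n"
    have "measure_pmf.prob (critical_pmf r n) {E. 16 / 2 ^ j * real n < vertices_ge n E (4 ^ j)} \<le>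
      measure_pmf.prob (critical_pmf r n) {E. \<sigma> \<le> \<bar>size_sum n E (\<lambda>c. exp (- s * real c)) / n - (1 - u)\<bar>}"
    proof (rule pmf_prob_mono, rule ccontr)
      fix E assume E: "E \<in> set_pmf (critical_pmf r n)"
        and large: "16 / 2 ^ j * real n < vertices_ge n E (4 ^ j)"
        and "\<not> \<sigma> \<le> \<bar>size_sum n E (\<lambda>c. exp (- s * real c)) / n - (1 - u)\<bar>"
      then have "1 - 2 * \<sigma> < size_sum n E (\<lambda>c. exp (- s * real c)) / n"
        using bounds(1) by linarith
      then have 1: "n - 2 * \<sigma> * n < size_sum n E (\<lambda>c. exp (- s * real c))"
        using n by (simp add: field_simps)
      have s: "\<sigma>\<^sup>2 / 4 \<le> s"
      proof -
        have "real (2 * (n div 2)) \<le> real n" by (intro of_nat_mono) auto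
        then have "u * (2 * (n div 2)) \<le> u * n" using bounds(2) \<sigma> by (intro mult_left_mono) auto
        then have "2 * u * (n div 2) / n \<le> u" using n by (simp add: field_simps)
        then show ?thesis using bounds(3) by (simp add: s_def)
      qed
      have s0: "0 \<le> s" using s zero_le_power2[of \<sigma>] by linarith
      have "of_bool (4 ^ j \<le> c) / 8 + exp (- s * real c) \<le> 1" for c :: nat
      proof (cases "4 ^ j \<le> c")
        case True
        then have "real (4 ^ j) \<le> real c" by (rule of_nat_mono)
        then have "\<sigma>\<^sup>2 / 4 * 4 ^ j \<le> s * c"
          using s s0 by (intro mult_mono) auto
        moreover have "\<sigma>\<^sup>2 * 4 ^ j = 1" 
        proof -
          have "(2 ^ j)\<^sup>2 = (4 ^ j :: real)" by (simp add: power2_eq_square flip: power_mult_distrib)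
          then show ?thesis by (simp add: \<sigma>_def power_divide)
        qed
        ultimately have "1 / 4 \<le> s * c" by simp
        then have "exp (- s * real c) \<le> exp (- (1 / 4))" by simp
        also have "\<dots> \<le> 7 / 8" using exp_minus_le[of "1/4"] by (simp add: power2_eq_square)
        finally show ?thesis using True by simp
      next
        case False
        then show ?thesis using s0 by simp
      qed
      then have "size_sum n E (\<lambda>c. of_bool (4 ^ j \<le> c) / 8 + exp (- s * real c)) \<le> size_sum n E (\<lambda>_. 1)"
        by (intro size_sum_mono edges_on_graph_pmf[OF r n edges_on_empty E]) blast
      then have "vertices_ge n E (4 ^ j) / 8 + size_sum n E (\<lambda>c. exp (- s * real c)) \<le> n"
        unfolding vertices_ge_eq_size_sum size_sum_def sum_divide_distrib sum.distrib by simp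
      with 1 have "vertices_ge n E (4 ^ j) / 8 < 2 * \<sigma> * n" by linarith
      then show False using large by (simp add: \<sigma>_def)
    qed
    also have "\<dots> \<le> ?K / n"
      unfolding s_def u_def
      by (rule critical_transform_concentration) (use r n \<sigma> \<open>u < \<sigma>\<close> in \<open>auto simp: u_def\<close>)
    finally show ?thesis .
  qed
  then show ?thesis
    by (intro tendsto_0_if_le_const_over_n[where K = ?K] eventually_mono[OF eventually_gt_at_top[of 0]]) auto
qed

text \<open>
  By \<open>1 - exp (-s c) \<le> s c\<close>, the susceptibility is at least \<open>w / s\<close>, where \<open>w\<close> is the average of
  \<open>1 - exp (-s |C(v)|)\<close>.  On the characteristic from \<open>\<sigma>\<close> this is at least \<open>(u / 2) / \<sigma>^2 \<ge> 1 / (4 \<sigma>)\<close>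
  with high probability, and \<open>\<sigma>\<close> is free.
\<close>

lemma critical_susceptibility:
  assumes r: "r > 0" and C: "C > 0"
  shows "(\<lambda>n. measure_pmf.prob (critical_pmf r n) {E. susceptibility n E \<le> C}) \<longlonglongrightarrow> 0"
proof -
  \<comment> \<open>This makes the lower bound \<open>1 / (4 * \<sigma>)\<close> for the susceptibility exceed \<open>C\<close>.\<close>
  define \<sigma> where "\<sigma> = 1 / (1 + 4 * C)"
  define u where "u = 1 - exp (- \<sigma>)"
  have \<sigma>: "0 < \<sigma>" "\<sigma> \<le> 1" using C by (auto simp: \<sigma>_def)
  note bounds = characteristic_bounds[OF \<sigma>, folded u_def]
  have "u < \<sigma>" using bounds(3) zero_less_power[OF \<sigma>(1), of 2] by linarith
  have u: "0 < u" using bounds(2) \<sigma> by linarith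
  let ?K = "exp (4 / (\<sigma> - u)) * 40 / ((\<sigma> - u)\<^sup>2 * (u / 2)\<^sup>2)"
  have "measure_pmf.prob (critical_pmf r n) {E. susceptibility n E \<le> C} \<le> ?K / n"
    if large: "real n > 2 / \<sigma>" for n
  proof -
    have "0 < 2 / \<sigma>" using \<sigma> by simp
    then have n: "n > 0" using large by (cases n) auto
    define s where "s = \<sigma> - 2 * u * (n div 2) / n"
    have "measure_pmf.prob (critical_pmf r n) {E. susceptibility n E \<le> C} \<le>
      measure_pmf.prob (critical_pmf r n) {E. u / 2 \<le> \<bar>size_sum n E (\<lambda>c. exp (- s * real c)) / n - (1 - u)\<bar>}"
    proof (rule pmf_prob_mono, rule ccontr)
      fix E assume E: "E \<in> set_pmf (critical_pmf r n)"
        and small: "susceptibility n E \<le> C"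
        and "\<not> u / 2 \<le> \<bar>size_sum n E (\<lambda>c. exp (- s * real c)) / n - (1 - u)\<bar>"
      then have "size_sum n E (\<lambda>c. exp (- s * real c)) / n < 1 - u / 2" by linarith
      then have 1: "size_sum n E (\<lambda>c. exp (- s * real c)) < n - u / 2 * n"
        using n by (simp add: field_simps)
      have E': "edges_on n E" by (rule edges_on_graph_pmf[OF r n edges_on_empty E])
      have s: "s \<le> \<sigma>\<^sup>2"
      proof -
        have "real n \<le> real (2 * (n div 2) + 1)" by (intro of_nat_mono) auto
        then have "u * (real n - 1) / n \<le> u * (2 * (n div 2)) / n"
          using u by (intro divide_right_mono mult_left_mono) auto
        moreover have "u * (real n - 1) / n = u - u / n" using n by (simp add: field_simps)
        ultimately have "u - u / n \<le> 2 * u * (n div 2) / n" by (simp add: mult_ac)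
        moreover have "u / n \<le> \<sigma>\<^sup>2 / 2"
        proof -
          have "u / n \<le> \<sigma> / n" using bounds(1) by (intro divide_right_mono) auto
          also have "\<dots> \<le> \<sigma>\<^sup>2 / 2" using large n \<sigma> by (simp add: field_simps power2_eq_square)
          finally show ?thesis .
        qed
        ultimately show ?thesis using bounds(4) by (simp add: s_def)
      qed
      have "size_sum n E (\<lambda>_. 1) \<le> size_sum n E (\<lambda>c. s * real c + exp (- s * real c))"
      proof (rule size_sum_mono[OF E'])
        show "1 \<le> s * real c + exp (- s * real c)" for c
          using exp_ge_add_one_self[of "- s * real c"] by simp
      qed
      then have "n \<le> s * size_sum n E real + size_sum n E (\<lambda>c. exp (- s * real c))"
        by (simp add: size_sum_def sum.distrib sum_distrib_left)
      then have "u / 2 * n < s * size_sum n E real" using 1 by linarith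
      also have "\<dots> \<le> \<sigma>\<^sup>2 * size_sum n E real"
        using s by (intro mult_right_mono) (auto simp: size_sum_def intro: sum_nonneg)
      also have "size_sum n E real = susceptibility n E * n"
        using n by (simp add: susceptibility_eq_size_sum[OF E'])
      also have "\<sigma>\<^sup>2 * (susceptibility n E * n) \<le> \<sigma>\<^sup>2 * (C * n)"
        using small by (intro mult_left_mono mult_right_mono) auto
      finally have "u / 2 < \<sigma>\<^sup>2 * C" using n by (simp add: mult.assoc[symmetric])
      then have "\<sigma> / 4 < \<sigma> * (\<sigma> * C)" using bounds(2) by (simp add: power2_eq_square)
      then have "1 / 4 < \<sigma> * C" using \<sigma> by (simp add: field_simps)
      then show False using C by (simp add: \<sigma>_def field_simps)
    qed
    also have "\<dots> \<le> ?K / n"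
      unfolding s_def u_def
      by (rule critical_transform_concentration) (use r n \<sigma> u \<open>u < \<sigma>\<close> in \<open>auto simp: u_def\<close>)
    finally show ?thesis .
  qed
  moreover have "\<forall>\<^sub>F n in sequentially. real n > 2 / \<sigma>"
    using filterlim_real_sequentially by (simp add: filterlim_at_top_dense)
  ultimately show ?thesis
    by (intro tendsto_0_if_le_const_over_n[where K = ?K]) (auto elim: eventually_mono)
qed

section \<open>The component tail under the sum rule\<close>

text \<open>
  If each of the first three pairs meets \<open>B\<close>, then \<open>B\<close> contains one of \<open>v 1, v 2\<close>, one of \<open>v 3, v 4\<close> and
  one of \<open>v 5, v 6\<close>.  Each of these eight combinations concerns three independent uniform vertices.
\<close>

lemma all_pairs_fraction:
  assumes r: "r \<ge> 3" and n: "n > 0" and B: "B \<subseteq> {1..n}"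
  shows "real (card {v \<in> offers r n. \<forall>l\<in>{1..r}. v (2 * l - 1) \<in> B \<or> v (2 * l) \<in> B}) / real n ^ (2 * r)
    \<le> 8 * (card B / n) ^ 3"
proof -
  define T :: "(nat \<times> nat \<times> nat) set" where "T = {1, 2} \<times> {3, 4} \<times> {5, 6}"
  define J :: "nat \<times> nat \<times> nat \<Rightarrow> nat set" where "J = (\<lambda>(a, b, c). {a, b, c})"
  let ?S = "\<lambda>t. {v \<in> offers r n. \<forall>j\<in>J t. v j \<in> B}"
  have finite_T: "finite T" and card_T: "card T = 8" by (simp_all add: T_def card_cartesian_product)
  have fraction: "real (card (?S t)) / real n ^ (2 * r) = (card B / n) ^ 3" if "t \<in> T" for t
  proof -
    have "J t \<subseteq> {1..2 * r}" "card (J t) = 3" using that r by (auto simp: T_def J_def)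
    then show ?thesis using offers_fraction[OF n, of "J t" r "\<lambda>_. B"] B by simp
  qed
  have "{v \<in> offers r n. \<forall>l\<in>{1..r}. v (2 * l - 1) \<in> B \<or> v (2 * l) \<in> B} \<subseteq> (\<Union>t\<in>T. ?S t)"
  proof
    fix v assume v: "v \<in> {v \<in> offers r n. \<forall>l\<in>{1..r}. v (2 * l - 1) \<in> B \<or> v (2 * l) \<in> B}"
    have pair: "v (2 * l - 1) \<in> B \<or> v (2 * l) \<in> B" if "l \<in> {1..3}" for l
      using v r that by auto
    obtain a b c where "a \<in> {1, 2}" "v a \<in> B" "b \<in> {3, 4}" "v b \<in> B" "c \<in> {5, 6}" "v c \<in> B"
      using pair[of 1] pair[of 2] pair[of 3] by auto
    then have "(a, b, c) \<in> T" "v \<in> ?S (a, b, c)" using v by (auto simp: T_def J_def)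
    then show "v \<in> (\<Union>t\<in>T. ?S t)" by blast
  qed
  then have "card {v \<in> offers r n. \<forall>l\<in>{1..r}. v (2 * l - 1) \<in> B \<or> v (2 * l) \<in> B} \<le> card (\<Union>t\<in>T. ?S t)"
    by (intro card_mono finite_UN_I finite_T) (auto simp: finite_offers)
  also have "\<dots> \<le> (\<Sum>t\<in>T. card (?S t))" by (rule card_UN_le[OF finite_T])
  finally have "real (card {v \<in> offers r n. \<forall>l\<in>{1..r}. v (2 * l - 1) \<in> B \<or> v (2 * l) \<in> B}) \<le> (\<Sum>t\<in>T. real (card (?S t)))"
    by (simp flip: of_nat_sum)
  then have "real (card {v \<in> offers r n. \<forall>l\<in>{1..r}. v (2 * l - 1) \<in> B \<or> v (2 * l) \<in> B}) / real n ^ (2 * r)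
      \<le> (\<Sum>t\<in>T. real (card (?S t)) / real n ^ (2 * r))"
    unfolding sum_divide_distrib[symmetric] by (rule divide_right_mono) simp
  also have "\<dots> = (\<Sum>t\<in>T. (card B / n) ^ 3)" by (intro sum.cong refl fraction)
  finally show ?thesis by (simp add: card_T)
qed

lemma vertices_ge_next_graph_mono:
  assumes "r > 0" "edges_on n E" "v \<in> offers r n"
  shows "vertices_ge n E k \<le> vertices_ge n (next_graph r n i E v) k"
proof -
  obtain a b where "next_graph r n i E v = insert {a, b} E" "a \<in> {1..n}" "b \<in> {1..n}"
  proof (cases "Suc i \<le> n div 2")
    case True
    have "1 \<in> {1..2 * r}" "2 \<in> {1..2 * r}" using assms(1) by auto
    with True that[of "v 1" "v 2"] offers_mem[OF assms(3)] show ?thesis by (simp add: next_graph_def)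
  next
    case False
    obtain a b where "sum_rule_pair r E v = {a, b}" "a \<in> {1..n}" "b \<in> {1..n}"
      using sum_rule_pair_vertices[OF assms(1,3), of E] by metis
    then show ?thesis using that[of a b] False by (simp add: next_graph_def)
  qed
  then show ?thesis using vertices_ge_insert(1)[OF assms(2)] by simp
qed

text \<open>
  The rule adds the pair with the smallest sum of component sizes.  Hence if that sum is at least \<open>k\<close>,
  so is the sum for every offered pair, which therefore meets a component of size at least \<open>k' \<le> k / 2\<close>.
\<close>

lemma vertices_ge_sum_rule_step:
  fixes k k' :: nat
  assumes r: "r > 0" and E: "edges_on n E" and v: "v \<in> offers r n" and i: "n div 2 \<le> i"
    and k: "2 * k' \<le> k"
  defines "B \<equiv> {w \<in> {1..n}. k' \<le> csize E w}"
  shows "vertices_ge n (next_graph r n i E v) k \<le> vertices_ge n E k +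
    (if \<forall>l\<in>{1..r}. v (2 * l - 1) \<in> B \<or> v (2 * l) \<in> B then 2 * k else 0)"
proof -
  obtain j where j: "j \<in> {1..r}" "j = sum_rule_index r E v"
    "sum_rule_pair r E v = {v (2 * j - 1), v (2 * j)}"
    "v (2 * j - 1) \<in> {1..n}" "v (2 * j) \<in> {1..n}"
    using sum_rule_pair_vertices[OF r v, of E] by blast
  have next_eq: "next_graph r n i E v = insert {v (2 * j - 1), v (2 * j)} E"
    using i j(3) by (simp add: next_graph_def)
  have all_large: "\<forall>l\<in>{1..r}. v (2 * l - 1) \<in> B \<or> v (2 * l) \<in> B"
    if large: "k \<le> csize E (v (2 * j - 1)) + csize E (v (2 * j))"
  proof
    fix l assume l: "l \<in> {1..r}"
    have "csize E (v (2 * j - 1)) + csize E (v (2 * j)) \<le> csize E (v (2 * l - 1)) + csize E (v (2 * l))"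
      unfolding j(2) by (rule sum_rule_index_properties(2)[OF r l])
    then have "k' \<le> csize E (v (2 * l - 1)) \<or> k' \<le> csize E (v (2 * l))" using large k by linarith
    moreover have "2 * l - 1 \<in> {1..2 * r}" "2 * l \<in> {1..2 * r}" using l by auto
    then have "v (2 * l - 1) \<in> {1..n} \<and> v (2 * l) \<in> {1..n}" using offers_mem[OF v] by blast
    ultimately show "v (2 * l - 1) \<in> B \<or> v (2 * l) \<in> B" unfolding B_def by blast
  qed
  have "vertices_ge n (next_graph r n i E v) k \<le> vertices_ge n E k +
      (if k \<le> csize E (v (2 * j - 1)) + csize E (v (2 * j)) then 2 * k else 0)"
    unfolding next_eq by (rule vertices_ge_insert(2)[OF E j(4,5)])
  also have "\<dots> \<le> vertices_ge n E k +
      (if \<forall>l\<in>{1..r}. v (2 * l - 1) \<in> B \<or> v (2 * l) \<in> B then 2 * k else 0)"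
    using all_large by (cases "k \<le> csize E (v (2 * j - 1)) + csize E (v (2 * j))") simp_all
  finally show ?thesis .
qed

text \<open>
  The exponential moment of \<open>vertices_ge n E k / (2 * k)\<close>, an amount that increases by at most 1 per step,
  restricted to the event that the tail at \<open>k'\<close> is still at most \<open>b * n\<close>.  While that event lasts, an
  increase has probability at most \<open>8 * b ^ 3\<close>.  As the tail at \<open>k'\<close> never decreases, the event cannot
  recur once it has failed, so a function of the current graph suffices.
\<close>

lemma sum_rule_growth:
  fixes b a B :: real and k k' :: nat
  assumes r: "r \<ge> 3" and n: "n > 0" and E0: "edges_on n E0" and i: "n div 2 \<le> i"
    and k: "2 * k' \<le> k" "k > 0" and b: "b \<ge> 0" and init: "vertices_ge n E0 k \<le> a * n"
  shows "measure_pmf.prob (graph_pmf r n i E0 m)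
      {E. B * n < vertices_ge n E k \<and> vertices_ge n E k' \<le> b * n}
    \<le> exp (16 * b ^ 3 * m - (B - a) * n / (2 * k))"
proof -
  have r0: "r > 0" using r by simp
  define \<Phi> where "\<Phi> = (\<lambda>E. exp (vertices_ge n E k / (2 * k)) * of_bool (vertices_ge n E k' \<le> b * n))"
  let ?p = "graph_pmf r n i E0 m"
  have "measure_pmf.expectation ?p \<Phi> \<le> (1 + 16 * b ^ 3) ^ m * (\<Phi> E0 + real m * 0)"
  proof (rule expectation_graph_pmf_le[where h = "\<lambda>_. \<Phi>" and m = m and c = "1 + 16 * b ^ 3" and d = 0, OF r0 n E0])
    fix j F assume F: "edges_on n F"
    show "(\<Sum>v\<in>offers r n. \<Phi> (next_graph r n (i + j) F v)) / real n ^ (2 * r) \<le> (1 + 16 * b ^ 3) * \<Phi> F + 0"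
    proof (cases "vertices_ge n F k' \<le> b * n")
      case False
      have "\<Phi> (next_graph r n (i + j) F v) = 0" if "v \<in> offers r n" for v
      proof -
        have "real (vertices_ge n F k') \<le> real (vertices_ge n (next_graph r n (i + j) F v) k')"
          using vertices_ge_next_graph_mono[OF r0 F that] by simp
        then show ?thesis using False by (simp add: \<Phi>_def)
      qed
      then show ?thesis using False by (simp add: \<Phi>_def)
    next
      case True
      define S where "S = {w \<in> {1..n}. k' \<le> csize F w}"
      define bad where "bad = {v \<in> offers r n. \<forall>l\<in>{1..r}. v (2 * l - 1) \<in> S \<or> v (2 * l) \<in> S}"
      have \<Phi>_F: "\<Phi> F = exp (vertices_ge n F k / (2 * k))" using True by (simp add: \<Phi>_def)
      \<comment> \<open>A bad offer multiplies \<open>\<Phi>\<close> at most by \<open>exp 1 \<le> 3\<close>, any other offer does not increase it.\<close>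
      have "\<Phi> (next_graph r n (i + j) F v) \<le> \<Phi> F * (1 + 2 * of_bool (v \<in> bad))" if v: "v \<in> offers r n" for v
      proof -
        have "vertices_ge n (next_graph r n (i + j) F v) k \<le> vertices_ge n F k + (if v \<in> bad then 2 * k else 0)"
          using vertices_ge_sum_rule_step[OF r0 F v, of "i + j" k' k] i k v
          by (simp add: bad_def S_def)
        then have "real (vertices_ge n (next_graph r n (i + j) F v) k) \<le> real (vertices_ge n F k + (if v \<in> bad then 2 * k else 0))"
          by (rule of_nat_mono)
        also have "\<dots> = vertices_ge n F k + 2 * k * of_bool (v \<in> bad)" by simp
        finally have "vertices_ge n (next_graph r n (i + j) F v) k / (2 * k) \<le> (vertices_ge n F k + 2 * k * of_bool (v \<in> bad)) / (2 * k)"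
          by (rule divide_right_mono) simp
        also have "\<dots> = vertices_ge n F k / (2 * k) + of_bool (v \<in> bad)"
          using k by (simp add: add_divide_distrib)
        finally have "\<Phi> (next_graph r n (i + j) F v) \<le> exp (vertices_ge n F k / (2 * k) + of_bool (v \<in> bad))"
          by (simp add: \<Phi>_def)
        also have "\<dots> \<le> \<Phi> F * (1 + 2 * of_bool (v \<in> bad))"
          using exp_le by (simp add: \<Phi>_F exp_add)
        finally show ?thesis .
      qed
      then have "(\<Sum>v\<in>offers r n. \<Phi> (next_graph r n (i + j) F v)) \<le> (\<Sum>v\<in>offers r n. \<Phi> F * (1 + 2 * of_bool (v \<in> bad)))"
        by (rule sum_mono)
      also have "\<dots> = \<Phi> F * (real n ^ (2 * r) + 2 * card bad)"
      proof -
        have "(\<Sum>v\<in>offers r n. of_bool (v \<in> bad)) = real (card bad)"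
          using finite_offers by (simp add: of_bool_def sum.If_cases bad_def Int_def)
        then show ?thesis
          by (simp add: sum.distrib card_offers flip: sum_distrib_left)
      qed
      finally have "(\<Sum>v\<in>offers r n. \<Phi> (next_graph r n (i + j) F v)) / real n ^ (2 * r) \<le> \<Phi> F * (1 + 2 * (card bad / real n ^ (2 * r)))"
        using n by (simp add: field_simps)
      also have "card bad / real n ^ (2 * r) \<le> 8 * b ^ 3"
      proof -
        have "card bad / real n ^ (2 * r) \<le> 8 * (card S / n) ^ 3"
          unfolding bad_def by (rule all_pairs_fraction[OF r n]) (auto simp: S_def)
        moreover have "real (card S) / n \<le> b"
          using True n by (simp add: S_def vertices_ge_def field_simps)
        then have "(card S / n) ^ 3 \<le> b ^ 3" by (intro power_mono) auto
        ultimately show ?thesis by linarith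
      qed
      then have "\<Phi> F * (1 + 2 * (card bad / real n ^ (2 * r))) \<le> \<Phi> F * (1 + 16 * b ^ 3)"
        by (intro mult_left_mono) (auto simp: \<Phi>_F)
      finally show ?thesis by (simp add: mult.commute)
    qed
  qed (use b in auto)
  also have "\<dots> \<le> exp (16 * b ^ 3 * m) * exp (a * n / (2 * k))"
  proof (rule mult_mono)
    have "(1 + 16 * b ^ 3) ^ m \<le> exp (16 * b ^ 3) ^ m"
      using b exp_ge_add_one_self[of "16 * b ^ 3"] by (intro power_mono) auto
    then show "(1 + 16 * b ^ 3) ^ m \<le> exp (16 * b ^ 3 * m)"
      by (simp add: exp_of_nat2_mult)
    have "vertices_ge n E0 k / (2 * k) \<le> a * n / (2 * k)" using init by (rule divide_right_mono) simp
    then show "\<Phi> E0 + real m * 0 \<le> exp (a * n / (2 * k))" by (auto simp: \<Phi>_def)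
  qed (auto simp: \<Phi>_def)
  finally have expectation: "measure_pmf.expectation ?p \<Phi> \<le> exp (16 * b ^ 3 * m) * exp (a * n / (2 * k))" .
  have "measure_pmf.prob ?p {E. B * n < vertices_ge n E k \<and> vertices_ge n E k' \<le> b * n}
      \<le> measure_pmf.prob ?p {E. exp (B * n / (2 * k)) \<le> \<Phi> E}"
  proof (rule pmf_prob_mono)
    fix E assume E: "B * n < vertices_ge n E k \<and> vertices_ge n E k' \<le> b * n"
    then have "B * n / (2 * k) \<le> vertices_ge n E k / (2 * k)" by (intro divide_right_mono) auto
    then show "exp (B * n / (2 * k)) \<le> \<Phi> E" using E by (simp add: \<Phi>_def)
  qed
  also have "\<dots> \<le> measure_pmf.expectation ?p \<Phi> / exp (B * n / (2 * k))"
    by (intro pmf_markov finite_set_graph_pmf n) (auto simp: \<Phi>_def)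
  also have "\<dots> \<le> exp (16 * b ^ 3 * m) * exp (a * n / (2 * k)) / exp (B * n / (2 * k))"
    using expectation by (rule divide_right_mono) simp
  also have "\<dots> = exp (16 * b ^ 3 * m - (B - a) * n / (2 * k))"
    by (simp add: left_diff_distrib diff_divide_distrib flip: exp_add exp_diff)
  finally show ?thesis .
qed

lemma graph_pmf_add:
  "graph_pmf r n 0 E (i + m) = graph_pmf r n 0 E i \<bind> (\<lambda>F. graph_pmf r n i F m)"
  by (induction m) (simp_all add: bind_return_pmf' bind_assoc_pmf)

text \<open>
  Used to restart the chain at time \<open>n div 2\<close>: \<open>P\<close> is the unlikely event that the critical graph is bad.
\<close>

lemma prob_bind_le:
  assumes "finite (set_pmf p)" "\<And>x. x \<in> set_pmf p \<Longrightarrow> finite (set_pmf (f x))" "0 \<le> K"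
    and "\<And>x. x \<in> set_pmf p \<Longrightarrow> \<not> P x \<Longrightarrow> measure_pmf.prob (f x) S \<le> K"
  shows "measure_pmf.prob (p \<bind> f) S \<le> measure_pmf.prob p {x. P x} + K"
proof -
  have "measure_pmf.prob (p \<bind> f) S = measure_pmf.expectation (p \<bind> f) (indicator S)" by simp
  also have "\<dots> = measure_pmf.expectation p (\<lambda>x. measure_pmf.prob (f x) S)"
    by (subst expectation_bind_finite) (use assms in auto)
  also have "\<dots> \<le> measure_pmf.expectation p (\<lambda>x. indicator {x. P x} x + K)"
  proof (intro integral_mono_AE integrable_measure_pmf_finite assms(1))
    show "AE x in measure_pmf p. measure_pmf.prob (f x) S \<le> indicator {x. P x} x + K"
    proof (subst AE_measure_pmf_iff, rule ballI)
      fix x assume "x \<in> set_pmf p"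
      then show "measure_pmf.prob (f x) S \<le> indicator {x. P x} x + K"
        using assms(3,4) measure_pmf.prob_le_1[of "f x" S] by (cases "P x") (auto intro: add_increasing2)
    qed
  qed
  also have "\<dots> = measure_pmf.prob p {x. P x} + K"
    by (simp add: integrable_measure_pmf_finite assms(1))
  finally show ?thesis .
qed

text \<open>
  The induction over the levels \<open>k = 4 ^ j\<close>.  At time \<open>n div 2\<close> the tail at \<open>k\<close> is at most \<open>16 n / 2 ^ j\<close>,
  and it must not exceed \<open>32 n / 2 ^ j\<close>; in units of \<open>2 * k\<close> the difference is \<open>8 n / 8 ^ j\<close>.  The
  bound at the preceding level is \<open>b = 64 / 2 ^ j\<close>, so the exponential moment grows by at most
  \<open>16 * b ^ 3 = 2 ^ 22 / 8 ^ j\<close> per step in the exponent, which over \<open>n / 2 ^ 22\<close> steps adds up to \<open>n / 8 ^ j\<close>.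
  Both amounts scale in the same way with \<open>j\<close>, which is why one \<open>\<delta> = 1 / 2 ^ 22\<close> serves all levels.
\<close>

lemma late_tail:
  fixes m :: "nat \<Rightarrow> nat"
  assumes r: "r \<ge> 3" and m: "\<And>n. m n \<le> real n / 2 ^ 22 + 1"
  shows "(\<lambda>n. measure_pmf.prob (graph_pmf r n 0 {} (n div 2 + m n))
      {E. 32 / 2 ^ j * real n < vertices_ge n E (4 ^ j)}) \<longlonglongrightarrow> 0"
proof (induction j)
  case 0
  have "{E. 32 / 2 ^ 0 * real n < vertices_ge n E (4 ^ 0)} = {}" for n
    using vertices_ge_le[of n _ 1] by (auto simp: not_less intro: order_trans[of _ "real n"])
  then show ?case by simp
next
  case (Suc j)
  have r0: "r > 0" using r by simp
  let ?p = "\<lambda>n. graph_pmf r n 0 {} (n div 2 + m n)"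
  let ?late = "\<lambda>j n. measure_pmf.prob (?p n) {E. 32 / 2 ^ j * real n < vertices_ge n E (4 ^ j)}"
  let ?crit = "\<lambda>n. measure_pmf.prob (critical_pmf r n) {E. 16 / 2 ^ Suc j * real n < vertices_ge n E (4 ^ Suc j)}"
  let ?q = "1 / 8 ^ Suc j :: real"
  let ?K = "\<lambda>n::nat. exp (2 ^ 22 - 7 * ?q * n)"
  have bound: "?late (Suc j) n \<le> ?late j n + (?crit n + ?K n)" if n: "n > 0" for n
  proof -
    let ?S = "{E. 32 / 2 ^ Suc j * real n < vertices_ge n E (4 ^ Suc j) \<and>
               real (vertices_ge n E (4 ^ j)) \<le> 32 / 2 ^ j * real n}"
    let ?T = "{E. 32 / 2 ^ j * real n < vertices_ge n E (4 ^ j)}"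
    have "?late (Suc j) n \<le> measure_pmf.prob (?p n) (?T \<union> ?S)"
      by (intro measure_pmf.finite_measure_mono) (auto simp: not_less)
    also have "\<dots> \<le> ?late j n + measure_pmf.prob (?p n) ?S"
      by (rule measure_Un_le) auto
    also have "measure_pmf.prob (?p n) ?S \<le> ?crit n + ?K n"
      unfolding graph_pmf_add
    proof (rule prob_bind_le)
      fix E assume E: "E \<in> set_pmf (critical_pmf r n)"
        and init: "\<not> 16 / 2 ^ Suc j * real n < vertices_ge n E (4 ^ Suc j)"
      have "measure_pmf.prob (graph_pmf r n (n div 2) E (m n)) ?S
        \<le> exp (16 * (32 / 2 ^ j) ^ 3 * m n - (32 / 2 ^ Suc j - 16 / 2 ^ Suc j) * n / (2 * (4 ^ Suc j :: nat)))"
        by (rule sum_rule_growth[OF r n edges_on_graph_pmf[OF r0 n edges_on_empty E]]) (use init in auto)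
      also have "\<dots> \<le> ?K n"
      proof -
        have pow24: "(2::real) ^ j * 4 ^ j = 8 ^ j" by (simp flip: power_mult_distrib)
        have "((2::real) ^ j) ^ 3 = (2 ^ 3) ^ j" by (simp only: power_mult[symmetric] mult.commute)
        then have pow: "((2::real) ^ j) ^ 3 = 8 ^ j" by simp
        have 1: "16 * (32 / 2 ^ j) ^ 3 = 2 ^ 22 * ?q"
          by (simp add: power_divide pow)
        have 2: "(32 / 2 ^ Suc j - 16 / 2 ^ Suc j) * n / (2 * (4 ^ Suc j :: nat)) = 8 * ?q * n"
          by (simp add: field_simps flip: pow24)
        have "2 ^ 22 * ?q * m n \<le> 2 ^ 22 * ?q * (real n / 2 ^ 22 + 1)"
          using m[of n] by (intro mult_left_mono) auto
        also have "\<dots> = ?q * n + 2 ^ 22 * ?q" by (simp add: distrib_left add_divide_distrib)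
        also have "2 ^ 22 * ?q \<le> 2 ^ 22"
          using one_le_power[of "8::real" "Suc j"] by (simp add: divide_le_eq)
        finally show ?thesis unfolding 1 2 by simp
      qed
      finally show "measure_pmf.prob (graph_pmf r n (n div 2) E (m n)) ?S \<le> ?K n" .
    qed (auto simp: finite_set_graph_pmf n)
    finally show ?thesis by simp
  qed
  have "?K \<longlonglongrightarrow> 0"
  proof -
    have "(\<lambda>n. exp (2 ^ 22) * exp (- 7 * ?q) ^ n) \<longlonglongrightarrow> exp (2 ^ 22) * 0"
      by (intro tendsto_mult_left LIMSEQ_power_zero) simp
    moreover have "exp (2 ^ 22) * exp (- 7 * ?q) ^ n = ?K n" for n
      by (simp add: mult_ac flip: exp_add exp_of_nat_mult)
    ultimately show ?thesis by (simp only: mult_zero_right)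
  qed
  then have "(\<lambda>n. ?late j n + (?crit n + ?K n)) \<longlonglongrightarrow> 0 + (0 + 0)"
    by (intro tendsto_add Suc.IH critical_tail r0)
  then have lim: "(\<lambda>n. ?late j n + (?crit n + ?K n)) \<longlonglongrightarrow> 0" by simp
  show ?case
  proof (rule tendsto_sandwich[OF _ _ tendsto_const lim])
    show "\<forall>\<^sub>F n in sequentially. 0 \<le> ?late (Suc j) n" by simp
    show "\<forall>\<^sub>F n in sequentially. ?late (Suc j) n \<le> ?late j n + (?crit n + ?K n)"
      by (rule eventually_mono[OF eventually_gt_at_top[of 0]]) (rule bound)
  qed
qed

lemma late_L1:
  fixes m :: "nat \<Rightarrow> nat"
  assumes r: "r \<ge> 3" and m: "\<And>n. m n \<le> real n / 2 ^ 22 + 1" and \<epsilon>: "\<epsilon> > 0"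
  shows "(\<lambda>n. measure_pmf.prob (graph_pmf r n 0 {} (n div 2 + m n)) {E. \<epsilon> < L1 n E / n}) \<longlonglongrightarrow> 0"
proof -
  have r0: "r > 0" using r by simp
  obtain j where j: "32 / 2 ^ j < \<epsilon>"
  proof -
    obtain j where "(1 / 2) ^ j < \<epsilon> / 32"
      using real_arch_pow_inv[of "\<epsilon> / 32" "1 / 2"] \<epsilon> by auto
    then show thesis using that[of j] by (simp add: power_one_over field_simps)
  qed
  show ?thesis
  proof (rule tendsto_sandwich[OF _ _ tendsto_const late_tail[OF r m, of j]])
    show "\<forall>\<^sub>F n in sequentially. measure_pmf.prob (graph_pmf r n 0 {} (n div 2 + m n)) {E. \<epsilon> < L1 n E / n}
      \<le> measure_pmf.prob (graph_pmf r n 0 {} (n div 2 + m n)) {E. 32 / 2 ^ j * real n < vertices_ge n E (4 ^ j)}"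
    proof -
      have "\<forall>\<^sub>F n in sequentially. real n > 4 ^ j / \<epsilon>"
        using filterlim_real_sequentially by (simp add: filterlim_at_top_dense)
      then show ?thesis using eventually_gt_at_top[of 0]
      proof eventually_elim
        case (elim n)
        show ?case
        proof (rule pmf_prob_mono)
          fix E assume E: "E \<in> set_pmf (graph_pmf r n 0 {} (n div 2 + m n))" and "\<epsilon> < L1 n E / n"
          then have L: "\<epsilon> * n < L1 n E" using elim by (simp add: field_simps)
          have "real (4 ^ j) < \<epsilon> * n" using elim \<epsilon> by (simp add: field_simps)
          then have "4 ^ j \<le> L1 n E" using L by linarith
          then have "L1 n E \<le> vertices_ge n E (4 ^ j)"
            by (rule L1_le_vertices_ge[OF edges_on_graph_pmf[OF r0 elim(2) edges_on_empty E] elim(2)])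
          moreover have "32 / 2 ^ j * real n \<le> \<epsilon> * n" using j by (intro mult_right_mono) auto
          ultimately show "32 / 2 ^ j * real n < vertices_ge n E (4 ^ j)" using L by linarith
        qed
      qed
    qed
  qed auto
qed

theorem corollary19:
  fixes r :: nat
  assumes "r \<ge> 3"
  shows "\<exists>\<delta>::real. \<delta> > 0 \<and>
    tendsto_infinity_in_prob (choices r) (\<lambda>n \<omega>. susceptibility n (D_graph r n \<omega> (n div 2))) \<and>
    tendsto_in_prob (choices r)
      (\<lambda>n \<omega>. real (L1 n (D_graph r n \<omega> (nat \<lfloor>real n / 2 + \<delta> * real n\<rfloor>))) / real n) 0"
proof (intro exI[of _ "1 / 2 ^ 22"] conjI)
  have r: "r > 0" using assms by simp
  show "tendsto_infinity_in_prob (choices r) (\<lambda>n \<omega>. susceptibility n (D_graph r n \<omega> (n div 2)))"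
    unfolding tendsto_infinity_in_prob_def
  proof (intro conjI allI impI)
    fix C :: real assume "C > 0"
    show "(\<lambda>n. \<P>(\<omega> in choices r n. susceptibility n (D_graph r n \<omega> (n div 2)) \<le> C)) \<longlonglongrightarrow> 0"
      by (rule Lim_transform_eventually[OF critical_susceptibility[OF r \<open>C > 0\<close>]],
          rule eventually_mono[OF eventually_gt_at_top[of 0]])
         (rule prob_D_graph[OF r, symmetric])
  qed (rule D_graph_functional_measurable[OF r])
  let ?T = "\<lambda>n. nat \<lfloor>real n / 2 + 1 / 2 ^ 22 * real n\<rfloor>"
  \<comment> \<open>The number of steps in the second phase; the summand 1 in its bound below is due to rounding for
    odd \<open>n\<close>.\<close>
  define m where "m = (\<lambda>n. ?T n - n div 2)"
  have T: "n div 2 \<le> ?T n" "?T n \<le> real n / 2 + 1 / 2 ^ 22 * real n" for n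
  proof -
    have "real (2 * (n div 2)) \<le> real n" by (intro of_nat_mono) auto
    then have "real (n div 2) \<le> real n / 2 + 1 / 2 ^ 22 * real n" by simp
    then show "n div 2 \<le> ?T n" by (simp add: le_nat_iff le_floor_iff)
    show "?T n \<le> real n / 2 + 1 / 2 ^ 22 * real n" by (rule of_nat_floor) simp
  qed
  have m: "m n \<le> real n / 2 ^ 22 + 1" for n
  proof -
    have "real n \<le> real (2 * (n div 2) + 1)" by (intro of_nat_mono) auto
    then show ?thesis using T[of n] by (simp add: m_def of_nat_diff)
  qed
  have T_eq: "?T n = n div 2 + m n" for n using T(1)[of n] by (simp add: m_def)
  show "tendsto_in_prob (choices r) (\<lambda>n \<omega>. real (L1 n (D_graph r n \<omega> (?T n))) / real n) 0"
    unfolding tendsto_in_prob_def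
  proof (intro conjI allI impI)
    fix \<epsilon> :: real assume "\<epsilon> > 0"
    show "(\<lambda>n. \<P>(\<omega> in choices r n. \<bar>real (L1 n (D_graph r n \<omega> (?T n))) / real n - 0\<bar> > \<epsilon>)) \<longlonglongrightarrow> 0"
    proof (rule Lim_transform_eventually[OF late_L1[OF assms m \<open>\<epsilon> > 0\<close>]],
        rule eventually_mono[OF eventually_gt_at_top[of 0]])
      fix n :: nat assume n: "n > 0"
      have "\<bar>x / real n - 0\<bar> = x / real n" if "0 \<le> x" for x using that by simp
      then show "measure_pmf.prob (graph_pmf r n 0 {} (n div 2 + m n)) {E. \<epsilon> < L1 n E / n} =
          \<P>(\<omega> in choices r n. \<bar>real (L1 n (D_graph r n \<omega> (?T n))) / real n - 0\<bar> > \<epsilon>)"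
        unfolding T_eq by (simp only: prob_D_graph[OF r n, symmetric] of_nat_0_le_iff)
    qed
  qed (rule D_graph_functional_measurable[OF r])
qed simp

end
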